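(* Let $L$ be a completely regular Lindelöf frame and let $q:L\twoheadrightarrow L/C$ be a coz-onto frame quotient, where $C$ is a frame congruence on $L$. Then the canonical map $g:L/\iota\iota_*(C)\to L/C$ is the universal Lindelöfication of $L/C$.
   Context: In a frame, $a\prec b$ means there is $z$ with $a\wedge z=0$, $b\vee z=1$; $a\prec\prec b$ means there is a family $(z_r)_{r\in[0,1]\cap\mathbb{Q}}$ with $z_0=a$, $z_1=b$ and $z_r\prec z_s$ whenever $r<s$. A frame is completely regular if each element is a join of elements completely below ($\prec\prec$) it. A frame is Lindelöf if every cover of $1$ has a countable subcover. An element is cozero if it is a countable join of elements completely below it; the cozero elements of $M$ form a sub-$\sigma$-frame $\mathrm{Coz}\,M$ (a $\sigma$-frame is a bounded distributive lattice with countable joins over which binary meets distribute), and a frame homomorphism $f:M\to N$ restricts to a $\sigma$-frame homomorphism $\mathrm{Coz}\,f:\mathrm{Coz}\,M\to\mathrm{Coz}\,N$. A map $f$ of completely regular frames is coz-onto if $\mathrm{Coz}\,f$ is surjective. $\mathbb{C}L$ is the frame of frame congruences on $L$, ordered by inclusion, and $\mathbb{C}(\mathrm{Coz}\,L)$ is the frame of $\sigma$-frame congruences on $\mathrm{Coz}\,L$ (equivalence relations closed under finite meets and countable joins). Since $L$ is completely regular Lindelöf, it is isomorphic to the frame of $\sigma$-ideals of $\mathrm{Coz}\,L$ (via taking joins), and there is an injective frame homomorphism $\iota:\mathbb{C}(\mathrm{Coz}\,L)\to\mathbb{C}L$ sending a $\sigma$-frame congruence $D$ to the frame congruence on $L$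 generated by $D$; $\iota_*$ is its right adjoint. Thus $\iota\iota_*(C)$ is the frame congruence on $L$ generated by $\{(a,b)\in C\mid a,b\in\mathrm{Coz}\,L\}$; it is contained in $C$, and $g$ is the induced map. The universal Lindelöfication of a completely regular frame $M$ is its completely regular Lindelöf coreflection: a map from a completely regular Lindelöf frame to $M$ through which every frame homomorphism from a completely regular Lindelöf frame to $M$ factors uniquely (it is realised by the join map from the frame of $\sigma$-ideals of $\mathrm{Coz}\,M$ to $M$). Countable/dependent choice is assumed as needed. *)

theory Defs
  imports "HOL-Algebra.Galois_Connection" "HOL-Library.Countable_Set"
begin

section \<open>Frames and frame homomorphisms\<close>

locale frame = complete_lattice L for L (structure) +
  assumes meet_Sup_distrib:
    "\<lbrakk>a \<in> carrier L; S \<subseteq> carrier L\<rbrakk> \<Longrightarrow> a \<sqinter> \<Squnion>S = \<Squnion>((\<lambda>s. a \<sqinter> s) ` S)"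

text \<open>Homomorphisms are only constrained on carriers. Preservation of the bottom element is the case
  \<open>S = {}\<close> of the last clause.\<close>

definition frame_hom :: "'a gorder \<Rightarrow> 'b gorder \<Rightarrow> ('a \<Rightarrow> 'b) \<Rightarrow> bool" where
  "frame_hom M N f \<longleftrightarrow>
     f \<in> carrier M \<rightarrow> carrier N \<and>
     f \<top>\<^bsub>M\<^esub> = \<top>\<^bsub>N\<^esub> \<and>
     (\<forall>a\<in>carrier M. \<forall>b\<in>carrier M. f (a \<sqinter>\<^bsub>M\<^esub> b) = f a \<sqinter>\<^bsub>N\<^esub> f b) \<and>
     (\<forall>S\<subseteq>carrier M. f (\<Squnion>\<^bsub>M\<^esub>S) = \<Squnion>\<^bsub>N\<^esub>(f ` S))"


section \<open>Complete regularity, the Lindelof property and cozero elements\<close>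

definition rather_below :: "'a gorder \<Rightarrow> 'a \<Rightarrow> 'a \<Rightarrow> bool" where
  "rather_below L a b \<longleftrightarrow>
     a \<in> carrier L \<and> b \<in> carrier L \<and>
     (\<exists>z\<in>carrier L. a \<sqinter>\<^bsub>L\<^esub> z = \<bottom>\<^bsub>L\<^esub> \<and> b \<squnion>\<^bsub>L\<^esub> z = \<top>\<^bsub>L\<^esub>)"

definition completely_below :: "'a gorder \<Rightarrow> 'a \<Rightarrow> 'a \<Rightarrow> bool" where
  "completely_below L a b \<longleftrightarrow>
     (\<exists>z :: rat \<Rightarrow> 'a. z 0 = a \<and> z 1 = b \<and>
        (\<forall>r\<in>{0..1}. \<forall>s\<in>{0..1}. r < s \<longrightarrow> rather_below L (z r) (z s)))"

definition completely_regular_frame :: "'a gorder \<Rightarrow> bool" where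
  "completely_regular_frame L \<longleftrightarrow>
     frame L \<and>
     (\<forall>a\<in>carrier L. \<exists>S\<subseteq>carrier L. (\<forall>s\<in>S. completely_below L s a) \<and> a = \<Squnion>\<^bsub>L\<^esub>S)"

definition lindelof_frame :: "'a gorder \<Rightarrow> bool" where
  "lindelof_frame L \<longleftrightarrow>
     frame L \<and>
     (\<forall>S\<subseteq>carrier L. \<Squnion>\<^bsub>L\<^esub>S = \<top>\<^bsub>L\<^esub> \<longrightarrow> (\<exists>T\<subseteq>S. countable T \<and> \<Squnion>\<^bsub>L\<^esub>T = \<top>\<^bsub>L\<^esub>))"

definition cozero_elements :: "'a gorder \<Rightarrow> 'a set" where
  "cozero_elements L =
     {a \<in> carrier L. \<exists>S\<subseteq>carrier L. countable S \<and> (\<forall>s\<in>S. completely_below L s a) \<and> a = \<Squnion>\<^bsub>L\<^esub>S}"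

definition Coz :: "'a gorder \<Rightarrow> 'a gorder" where
  "Coz L = L\<lparr>carrier := cozero_elements L\<rparr>"

definition coz_onto :: "'a gorder \<Rightarrow> 'b gorder \<Rightarrow> ('a \<Rightarrow> 'b) \<Rightarrow> bool" where
  "coz_onto M N f \<longleftrightarrow> f ` carrier (Coz M) = carrier (Coz N)"


section \<open>Congruences and quotients\<close>

text \<open>Closure under joins is phrased through sets \<open>R\<close> of related pairs: the joins of the first and
  of the second components are related. The empty meet and the empty join are covered by reflexivity.\<close>

definition frame_congruence :: "'a gorder \<Rightarrow> 'a rel \<Rightarrow> bool" where
  "frame_congruence L C \<longleftrightarrow>
     equiv (carrier L) C \<and>
     (\<forall>(a, b)\<in>C. \<forall>(c, d)\<in>C. (a \<sqinter>\<^bsub>L\<^esub> c, b \<sqinter>\<^bsub>L\<^esub> d) \<in> C) \<and>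
     (\<forall>R\<subseteq>C. (\<Squnion>\<^bsub>L\<^esub>(fst ` R), \<Squnion>\<^bsub>L\<^esub>(snd ` R)) \<in> C)"

definition sigma_frame_congruence :: "'a gorder \<Rightarrow> 'a rel \<Rightarrow> bool" where
  "sigma_frame_congruence A D \<longleftrightarrow>
     equiv (carrier A) D \<and>
     (\<forall>(a, b)\<in>D. \<forall>(c, d)\<in>D. (a \<sqinter>\<^bsub>A\<^esub> c, b \<sqinter>\<^bsub>A\<^esub> d) \<in> D) \<and>
     (\<forall>R\<subseteq>D. countable R \<longrightarrow> (\<Squnion>\<^bsub>A\<^esub>(fst ` R), \<Squnion>\<^bsub>A\<^esub>(snd ` R)) \<in> D)"

definition frame_congruences :: "'a gorder \<Rightarrow> 'a rel gorder" where
  "frame_congruences L = \<lparr>carrier = {C. frame_congruence L C}, eq = (=), le = (\<subseteq>)\<rparr>"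

definition sigma_frame_congruences :: "'a gorder \<Rightarrow> 'a rel gorder" where
  "sigma_frame_congruences A = \<lparr>carrier = {D. sigma_frame_congruence A D}, eq = (=), le = (\<subseteq>)\<rparr>"

text \<open>In the quotient, \<open>[a] \<le> [b]\<close> means \<open>[a] = [a \<sqinter> b]\<close>.\<close>

definition quotient_frame :: "'a gorder \<Rightarrow> 'a rel \<Rightarrow> 'a set gorder" where
  "quotient_frame L C =
     \<lparr>carrier = carrier L // C, eq = (=),
      le = (\<lambda>X Y. \<exists>a\<in>X. \<exists>b\<in>Y. (a \<sqinter>\<^bsub>L\<^esub> b, a) \<in> C)\<rparr>"

definition quotient_map :: "'a rel \<Rightarrow> 'a \<Rightarrow> 'a set" where
  "quotient_map C a = C `` {a}"

text \<open>For \<open>E \<subseteq> C\<close>, the map from the quotient by \<open>E\<close> to the quotient by \<open>C\<close> through which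
  the quotient map of \<open>C\<close> factors; see the lemma below.\<close>

definition induced_quotient_map :: "'a rel \<Rightarrow> 'a set \<Rightarrow> 'a set" where
  "induced_quotient_map C X = C `` X"

lemma induced_quotient_map_quotient_map:
  assumes "equiv A E" "equiv A C" "E \<subseteq> C" "a \<in> A"
  shows "induced_quotient_map C (quotient_map E a) = quotient_map C a"
proof -
  have "(a, a) \<in> E"
    using assms(1,4) by (simp add: equiv_def refl_on_def)
  moreover have "trans C"
    using assms(2) by (simp add: equiv_def)
  ultimately show ?thesis
    using assms(3) unfolding induced_quotient_map_def quotient_map_def trans_def by blast
qed


section \<open>The embedding of congruence frames and its right adjoint\<close>

definition iota :: "'a gorder \<Rightarrow> 'a rel \<Rightarrow> 'a rel" where
  "iota L D = \<Inter>{C. frame_congruence L C \<and> D \<subseteq> C}"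

text \<open>A right adjoint is determined by the Galois connection on the carrier of \<open>Y\<close>.\<close>

definition right_adjoint :: "'a gorder \<Rightarrow> 'b gorder \<Rightarrow> ('a \<Rightarrow> 'b) \<Rightarrow> 'b \<Rightarrow> 'a" where
  "right_adjoint X Y f = (SOME u. galois_connection \<lparr>orderA = X, orderB = Y, lower = f, upper = u\<rparr>)"

definition iota_star :: "'a gorder \<Rightarrow> 'a rel \<Rightarrow> 'a rel" where
  "iota_star L = right_adjoint (sigma_frame_congruences (Coz L)) (frame_congruences L) (iota L)"


section \<open>The universal Lindelofication\<close>

text \<open>The type argument is the type of the elements of the test frames \<open>N\<close>; a theorem in which it is
  a type variable covers test frames over every type. Factorisations are taken extensional
  because two homomorphisms are identified when they agree on the carrier of \<open>N\<close>.\<close>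

definition universal_lindelofication ::
    "'c itself \<Rightarrow> 'a gorder \<Rightarrow> 'b gorder \<Rightarrow> ('a \<Rightarrow> 'b) \<Rightarrow> bool" where
  "universal_lindelofication (_ :: 'c itself) K M g \<longleftrightarrow>
     completely_regular_frame M \<and>
     completely_regular_frame K \<and> lindelof_frame K \<and>
     frame_hom K M g \<and>
     (\<forall>(N :: 'c gorder) h.
        completely_regular_frame N \<and> lindelof_frame N \<and> frame_hom N M h \<longrightarrow>
        (\<exists>!k. k \<in> extensional (carrier N) \<and> frame_hom N K k \<and> (\<forall>x\<in>carrier N. g (k x) = h x)))"

end

theory Submission
  imports Defs
begin

text \<open>
  Let \<open>q\<close> be the quotient map of \<open>C\<close>, and let \<open>E\<close> be the congruence on \<open>L\<close> generated by those pairs of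
  \<open>C\<close> whose components are cozero. The right adjoint of \<open>iota\<close> is restriction to the cozero elements
  (\<open>iota_star_eq\<close>), so \<open>E\<close> is the congruence of the theorem. The idea is that \<open>L/E\<close> and \<open>L/C\<close> have the
  same cozero elements: on cozero elements of \<open>L\<close> the two quotient maps make the same
  identifications (\<open>p_eq_if_q_eq\<close>), and since \<open>q\<close> is coz-onto, every cozero element of \<open>L/C\<close> is the
  image of a cozero element of \<open>L\<close>. What makes completely regular Lindelof frames depend only on
  their cozero elements is that every element is a join of cozero elements, and that a cozero element
  below an arbitrary join is already below a countable one (\<open>cozero_lindelof_refine\<close>); countable joins
  of cozero elements are again cozero, so they can be moved between the frames.

  Frames of \<open>\<sigma>\<close>-ideals are avoided. In their place stands the preorder \<open>coz_le\<close> on \<open>L\<close>: every cozero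
  element below \<open>a\<close> is, modulo \<open>C\<close>, below some cozero element lying under \<open>b\<close>. In terms of
  \<open>\<sigma>\<close>-ideals, the ideal of \<open>a\<close> becomes contained in that of \<open>b\<close> after passing to the quotient of the
  cozero elements. Its symmetric part is a frame congruence that contains the generators of \<open>E\<close>,
  hence it contains \<open>E\<close> (\<open>E_coz_le\<close>). This bounds \<open>E\<close> from above, and the Lindelof property of \<open>L/E\<close>
  follows: if a join is \<open>E\<close>-related to the top, then \<open>C\<close> relates the top to one cozero element
  below that join; \<open>E\<close> relates this element to the top as well, both being cozero, and it lies
  below a countable subjoin.

  Factorisations through \<open>L/E \<rightarrow> L/C\<close> are unique because this map is dense and the test frame is
  regular (\<open>dense_hom_agree\<close>). For existence, a homomorphism \<open>h : N \<rightarrow> L/C\<close> sends each cozero element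
  \<open>c\<close> of \<open>N\<close> to the class of some cozero element \<open>d\<close> of \<open>L\<close>, whose class modulo \<open>E\<close> depends on \<open>c\<close> alone;
  the factorisation sends \<open>x\<close> to the join of these classes over the cozero \<open>c\<close> below \<open>x\<close>.
\<close>


section \<open>Frames\<close>

text \<open>Complete regularity, cozero elements and homomorphisms are notions for order records without
  further fields, whereas \<^locale>\<open>frame\<close> admits record extensions; this locale restricts the type.\<close>

locale bare_frame = frame L for L :: "'a gorder" (structure)
begin

lemma bottom_eq_sup: "\<bottom> = \<Squnion>{}"
  using weak_sup_empty by (simp add: eq_is_equal)

lemma le_bottom_iff: "a \<in> carrier L \<Longrightarrow> a \<sqsubseteq> \<bottom> \<longleftrightarrow> a = \<bottom>"
  using le_antisym[OF _ bottom_lower, of a] by auto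

lemma top_le_iff: "a \<in> carrier L \<Longrightarrow> \<top> \<sqsubseteq> a \<longleftrightarrow> a = \<top>"
  using le_antisym[OF top_higher, of a] by auto

lemma le_iff_meet_eq: "\<lbrakk>a \<in> carrier L; b \<in> carrier L\<rbrakk> \<Longrightarrow> a \<sqsubseteq> b \<longleftrightarrow> a \<sqinter> b = a"
  by (subst le_iff_join) auto

lemma sup_mono:
  assumes "S \<subseteq> carrier L" "T \<subseteq> carrier L" "\<And>s. s \<in> S \<Longrightarrow> \<exists>t\<in>T. s \<sqsubseteq> t"
  shows "\<Squnion>S \<sqsubseteq> \<Squnion>T"
proof (rule sup_least)
  fix s assume "s \<in> S"
  then obtain t where "t \<in> T" "s \<sqsubseteq> t" using assms(3) by blast
  then show "s \<sqsubseteq> \<Squnion>T"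
    using assms \<open>s \<in> S\<close> by (meson le_trans subsetD sup_closed sup_upper)
qed (use assms in auto)

lemma sup_subset_mono: "\<lbrakk>S \<subseteq> T; T \<subseteq> carrier L\<rbrakk> \<Longrightarrow> \<Squnion>S \<sqsubseteq> \<Squnion>T"
  by (rule sup_mono) (blast intro: le_refl)+

lemma sup_upper': "\<lbrakk>S \<subseteq> carrier L; s \<in> S; a \<in> carrier L; a \<sqsubseteq> s\<rbrakk> \<Longrightarrow> a \<sqsubseteq> \<Squnion>S"
  by (rule le_trans[of a s]) (auto intro: sup_upper)

lemma meet_join_distrib:
  assumes "a \<in> carrier L" "b \<in> carrier L" "c \<in> carrier L"
  shows "a \<sqinter> (b \<squnion> c) = (a \<sqinter> b) \<squnion> (a \<sqinter> c)"
  using meet_Sup_distrib[of a "{b, c}"] assms by (simp add: join_def)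

lemma join_bottom: "a \<in> carrier L \<Longrightarrow> a \<squnion> \<bottom> = a"
  using bottom_join by (simp add: eq_is_equal join_comm)

lemma meet_top: "a \<in> carrier L \<Longrightarrow> a \<sqinter> \<top> = a"
  using top_meet by (simp add: eq_is_equal meet_comm)

lemma meet_bottom: "a \<in> carrier L \<Longrightarrow> a \<sqinter> \<bottom> = \<bottom>"
  using bottom_meet by (simp add: eq_is_equal meet_comm)

lemma meet_mono:
  assumes "a \<sqsubseteq> b" "c \<sqsubseteq> d"
    and "a \<in> carrier L" "b \<in> carrier L" "c \<in> carrier L" "d \<in> carrier L"
  shows "a \<sqinter> c \<sqsubseteq> b \<sqinter> d"
proof (rule meet_le)
  show "a \<sqinter> c \<sqsubseteq> b" using assms le_trans[OF meet_left[of a c] assms(1)] by simp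
  show "a \<sqinter> c \<sqsubseteq> d" using assms le_trans[OF meet_right[of a c] assms(2)] by simp
qed (use assms in auto)

lemma join_mono:
  assumes "a \<sqsubseteq> b" "c \<sqsubseteq> d"
    and "a \<in> carrier L" "b \<in> carrier L" "c \<in> carrier L" "d \<in> carrier L"
  shows "a \<squnion> c \<sqsubseteq> b \<squnion> d"
proof (rule join_le)
  show "a \<sqsubseteq> b \<squnion> d" using assms le_trans[OF assms(1) join_left[of b d]] by simp
  show "c \<sqsubseteq> b \<squnion> d" using assms le_trans[OF assms(2) join_right[of b d]] by simp
qed (use assms in auto)

text \<open>Distributivity applied to \<open>a \<sqinter> (b \<squnion> z)\<close>; this is how every inequality below is extracted from
  a rather-below relation.\<close>

lemma le_of_disjoint_cover:
  assumes "a \<in> carrier L" "b \<in> carrier L" "z \<in> carrier L" "a \<sqinter> z = \<bottom>" "b \<squnion> z = \<top>"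
  shows "a \<sqsubseteq> b"
proof -
  have "a = a \<sqinter> (b \<squnion> z)"
    using assms(1,5) by (simp add: meet_top)
  also have "\<dots> = a \<sqinter> b"
    unfolding meet_join_distrib[OF assms(1-3)] assms(4) using assms by (simp add: join_bottom)
  finally show ?thesis
    using assms meet_right by metis
qed

lemma sup_meet_sup:
  assumes "S \<subseteq> carrier L" "T \<subseteq> carrier L"
  shows "\<Squnion>S \<sqinter> \<Squnion>T = \<Squnion>{s \<sqinter> t | s t. s \<in> S \<and> t \<in> T}"
proof (rule le_antisym)
  let ?U = "{s \<sqinter> t | s t. s \<in> S \<and> t \<in> T}"
  have U: "?U \<subseteq> carrier L" using assms by (auto intro!: meet_closed)
  show "\<Squnion>?U \<in> carrier L" using U by simp
  show "\<Squnion>S \<sqinter> \<Squnion>T \<sqsubseteq> \<Squnion>?U"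
    unfolding meet_Sup_distrib[OF sup_closed[OF assms(1)] assms(2)]
  proof (rule sup_least)
    fix x assume "x \<in> (\<sqinter>) (\<Squnion>S) ` T"
    then obtain t where t: "t \<in> T" "x = t \<sqinter> \<Squnion>S" by (auto simp: meet_comm)
    then have x: "x = \<Squnion>((\<lambda>s. t \<sqinter> s) ` S)"
      using assms meet_Sup_distrib[of t S] by auto
    show "x \<sqsubseteq> \<Squnion>?U"
      unfolding x
    proof (rule sup_least)
      fix y assume "y \<in> (\<lambda>s. t \<sqinter> s) ` S"
      then have "y \<in> ?U" using t(1) by (auto simp: meet_comm)
      then show "y \<sqsubseteq> \<Squnion>?U" using U by (intro sup_upper)
    qed (use t(1) assms U in \<open>auto intro!: meet_closed\<close>)
  qed (use assms U in auto)
  show "\<Squnion>?U \<sqsubseteq> \<Squnion>S \<sqinter> \<Squnion>T"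
    using assms U by (intro sup_least) (auto intro!: meet_mono sup_upper)
qed (use assms in auto)


section \<open>The completely below relation and cozero elements\<close>

lemma rather_belowD: "rather_below L a b \<Longrightarrow> a \<in> carrier L \<and> b \<in> carrier L \<and> a \<sqsubseteq> b"
  unfolding rather_below_def by (metis le_of_disjoint_cover)

lemma rather_below_trans_le:
  assumes "rather_below L a b" "b \<sqsubseteq> c" "c \<in> carrier L"
  shows "rather_below L a c"
proof -
  obtain z where z: "a \<in> carrier L" "b \<in> carrier L" "z \<in> carrier L" "a \<sqinter> z = \<bottom>" "b \<squnion> z = \<top>"
    using assms(1) unfolding rather_below_def by blast
  then have "\<top> \<sqsubseteq> c \<squnion> z"
    using assms join_mono[of b c z z] by simp
  then show ?thesis
    unfolding rather_below_def using assms z top_le_iff by auto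
qed

lemma rather_below_meet:
  assumes "rather_below L a b" "rather_below L c d"
  shows "rather_below L (a \<sqinter> c) (b \<sqinter> d)"
proof -
  obtain z where z: "a \<in> carrier L" "b \<in> carrier L" "z \<in> carrier L" "a \<sqinter> z = \<bottom>" "b \<squnion> z = \<top>"
    using assms(1) unfolding rather_below_def by blast
  obtain w where w: "c \<in> carrier L" "d \<in> carrier L" "w \<in> carrier L" "c \<sqinter> w = \<bottom>" "d \<squnion> w = \<top>"
    using assms(2) unfolding rather_below_def by blast
  have "(a \<sqinter> c) \<sqinter> z \<sqsubseteq> a \<sqinter> z"
    using z(1-3) w(1) by (intro meet_mono meet_left) auto
  moreover have "(a \<sqinter> c) \<sqinter> w \<sqsubseteq> c \<sqinter> w"
    using z(1) w(1-3) by (intro meet_mono meet_right) auto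
  ultimately have disj: "(a \<sqinter> c) \<sqinter> (z \<squnion> w) = \<bottom>"
    using z w by (simp add: meet_join_distrib le_bottom_iff join_bottom)
  have "b = b \<sqinter> (d \<squnion> w)"
    using z(2) w(5) by (simp add: meet_top)
  also have "\<dots> = (b \<sqinter> d) \<squnion> (b \<sqinter> w)"
    using z(2) w(2,3) by (rule meet_join_distrib)
  also have "\<dots> \<sqsubseteq> (b \<sqinter> d) \<squnion> (z \<squnion> w)"
  proof (rule join_mono)
    show "b \<sqinter> w \<sqsubseteq> z \<squnion> w"
      using z w le_trans[OF meet_right[of b w] join_right[of z w]] by simp
  qed (use z w in auto)
  finally have "b \<sqsubseteq> (b \<sqinter> d) \<squnion> (z \<squnion> w)" .
  moreover have "z \<sqsubseteq> (b \<sqinter> d) \<squnion> (z \<squnion> w)"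
    using z w le_trans[OF join_left[of z w] join_right[of "b \<sqinter> d" "z \<squnion> w"]] by simp
  ultimately have "b \<squnion> z \<sqsubseteq> (b \<sqinter> d) \<squnion> (z \<squnion> w)"
    using z w by (intro join_le) auto
  then have "(b \<sqinter> d) \<squnion> (z \<squnion> w) = \<top>"
    using z w by (simp add: top_le_iff)
  then show ?thesis
    unfolding rather_below_def using z w disj by (intro conjI bexI[of _ "z \<squnion> w"]) auto
qed

lemma completely_belowD:
  assumes "completely_below L a b"
  shows "rather_below L a b" "a \<in> carrier L" "b \<in> carrier L" "a \<sqsubseteq> b"
proof -
  obtain z :: "rat \<Rightarrow> 'a" where "z 0 = a" "z 1 = b"
    "\<forall>r\<in>{0..1}. \<forall>s\<in>{0..1}. r < s \<longrightarrow> rather_below L (z r) (z s)"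
    using assms unfolding completely_below_def by blast
  then show "rather_below L a b" by force
  then show "a \<in> carrier L" "b \<in> carrier L" "a \<sqsubseteq> b" using rather_belowD by blast+
qed

lemma completely_below_trans_le:
  assumes "completely_below L a b" "b \<sqsubseteq> c" "c \<in> carrier L"
  shows "completely_below L a c"
proof -
  obtain z :: "rat \<Rightarrow> 'a" where z: "z 0 = a" "z 1 = b"
    "\<forall>r\<in>{0..1}. \<forall>s\<in>{0..1}. r < s \<longrightarrow> rather_below L (z r) (z s)"
    using assms unfolding completely_below_def by blast
  show ?thesis
    unfolding completely_below_def
    using z rather_below_trans_le[OF _ assms(2,3)]
    by (intro exI[of _ "z(1 := c)"]) auto
qed

lemma completely_below_meet:
  assumes "completely_below L a b" "completely_below L c d"
  shows "completely_below L (a \<sqinter> c) (b \<sqinter> d)"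
proof -
  obtain z :: "rat \<Rightarrow> 'a" where z: "z 0 = a" "z 1 = b"
    "\<forall>r\<in>{0..1}. \<forall>s\<in>{0..1}. r < s \<longrightarrow> rather_below L (z r) (z s)"
    using assms unfolding completely_below_def by blast
  obtain w :: "rat \<Rightarrow> 'a" where w: "w 0 = c" "w 1 = d"
    "\<forall>r\<in>{0..1}. \<forall>s\<in>{0..1}. r < s \<longrightarrow> rather_below L (w r) (w s)"
    using assms unfolding completely_below_def by blast
  show ?thesis
    unfolding completely_below_def
    using z w by (intro exI[of _ "\<lambda>r. z r \<sqinter> w r"]) (auto intro!: rather_below_meet)
qed

lemma completely_below_top: "completely_below L \<top> \<top>"
proof -
  have "rather_below L \<top> \<top>"
    unfolding rather_below_def
    by (intro conjI bexI[of _ \<bottom>]) (simp_all add: meet_bottom join_bottom)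
  then show ?thesis
    unfolding completely_below_def by (intro exI[of _ "\<lambda>_. \<top>"]) simp
qed

lemma cozero_carrier: "cozero_elements L \<subseteq> carrier L"
  by (auto simp: cozero_elements_def)

lemma cozeroD: "c \<in> cozero_elements L \<Longrightarrow> c \<in> carrier L"
  using cozero_carrier by blast

lemma cozeroI:
  assumes "S \<subseteq> carrier L" "countable S" "\<And>s. s \<in> S \<Longrightarrow> completely_below L s a" "a = \<Squnion>S"
  shows "a \<in> cozero_elements L"
  using assms by (auto simp: cozero_elements_def)

lemma cozeroE:
  assumes "a \<in> cozero_elements L"
  obtains S where "S \<subseteq> carrier L" "countable S" "\<forall>s\<in>S. completely_below L s a" "a = \<Squnion>S"
  using assms unfolding cozero_elements_def by (elim CollectE conjE exE)

lemma cozero_top: "\<top> \<in> cozero_elements L"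
  using completely_below_top by (intro cozeroI[of "{\<top>}"]) simp_all

lemma cozero_sup:
  assumes "S \<subseteq> cozero_elements L" "countable S"
  shows "\<Squnion>S \<in> cozero_elements L"
proof -
  have "\<forall>s\<in>S. \<exists>A\<subseteq>carrier L. countable A \<and> (\<forall>a\<in>A. completely_below L a s) \<and> s = \<Squnion>A"
    using assms(1) unfolding cozero_elements_def by blast
  then obtain A where A: "\<And>s. s \<in> S \<Longrightarrow> A s \<subseteq> carrier L \<and> countable (A s) \<and>
      (\<forall>a\<in>A s. completely_below L a s) \<and> s = \<Squnion>(A s)"
    by metis
  have S: "S \<subseteq> carrier L" using assms(1) cozero_carrier by blast
  let ?B = "\<Union>s\<in>S. A s"
  have B: "?B \<subseteq> carrier L" using A by blast
  have "\<Squnion>S = \<Squnion>?B"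
  proof (rule le_antisym)
    show "\<Squnion>S \<sqsubseteq> \<Squnion>?B"
    proof (rule sup_least)
      fix s assume s: "s \<in> S"
      then have "\<Squnion>(A s) \<sqsubseteq> \<Squnion>?B"
        using s B by (intro sup_subset_mono) auto
      then show "s \<sqsubseteq> \<Squnion>?B" using A s by simp
    qed (use S B in auto)
    show "\<Squnion>?B \<sqsubseteq> \<Squnion>S"
    proof (rule sup_least)
      fix a assume "a \<in> ?B"
      then obtain s where s: "s \<in> S" "a \<in> A s" by blast
      then have "completely_below L a s" using A by blast
      then have "a \<sqsubseteq> s" "a \<in> carrier L" by (rule completely_belowD)+
      then show "a \<sqsubseteq> \<Squnion>S" using S s(1) by (intro sup_upper')
    qed (use S B in auto)
  qed (use S B in auto)
  moreover have "completely_below L a (\<Squnion>S)" if "a \<in> ?B" for a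
    using that A completely_below_trans_le S sup_upper by (metis UN_E sup_closed)
  moreover have "countable ?B" using A assms(2) by auto
  ultimately show ?thesis
    using B by (intro cozeroI[of ?B]) simp_all
qed

lemma cozero_bottom: "\<bottom> \<in> cozero_elements L"
  using cozero_sup[of "{}"] by (simp add: bottom_eq_sup)

lemma cozero_meet:
  assumes "a \<in> cozero_elements L" "b \<in> cozero_elements L"
  shows "a \<sqinter> b \<in> cozero_elements L"
proof -
  obtain S where S: "S \<subseteq> carrier L" "countable S" "\<forall>s\<in>S. completely_below L s a" "a = \<Squnion>S"
    using assms(1) by (elim cozeroE)
  obtain T where T: "T \<subseteq> carrier L" "countable T" "\<forall>s\<in>T. completely_below L s b" "b = \<Squnion>T"
    using assms(2) by (elim cozeroE)
  let ?U = "{s \<sqinter> t | s t. s \<in> S \<and> t \<in> T}"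
  have "?U = (\<lambda>(s, t). s \<sqinter> t) ` (S \<times> T)" by auto
  then have "countable ?U" using S T by simp
  moreover have "?U \<subseteq> carrier L" using S(1) T(1) by (auto intro!: meet_closed)
  moreover have "a \<sqinter> b = \<Squnion>?U" using sup_meet_sup S T by simp
  moreover have "\<forall>u\<in>?U. completely_below L u (a \<sqinter> b)"
    using S(3) T(3) completely_below_meet by blast
  ultimately show ?thesis
    by (intro cozeroI[of ?U]) simp_all
qed

text \<open>The interpolating chain itself supplies the cozero element: the join of its members with index
  below 1. Each such member is completely below a later one, by rescaling the part of the chain
  between them to the unit interval.\<close>

lemma completely_below_cozero_between:
  assumes "completely_below L a b"
  obtains c where "c \<in> cozero_elements L" "a \<sqsubseteq> c" "c \<sqsubseteq> b"
proof -
  obtain z :: "rat \<Rightarrow> 'a" where z: "z 0 = a" "z 1 = b"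
    "\<forall>r\<in>{0..1}. \<forall>s\<in>{0..1}. r < s \<longrightarrow> rather_below L (z r) (z s)"
    using assms unfolding completely_below_def by blast
  have zc: "z r \<in> carrier L" if "r \<in> {0..1}" for r
  proof (cases "r = 1")
    case True
    then show ?thesis using z(2) completely_belowD(3)[OF assms] by simp
  next
    case False
    then have "rather_below L (z r) (z 1)" using that z(3) by simp
    then show ?thesis using rather_belowD by blast
  qed
  let ?S = "z ` {0..<1}"
  have S: "?S \<subseteq> carrier L" using zc by auto
  have "completely_below L (z r) (\<Squnion>?S)" if r: "r \<in> {0..<1}" for r
  proof -
    \<comment> \<open>any index strictly between \<open>r\<close> and 1 serves\<close>
    define s where "s = (r + 1) / 2"
    have s: "r < s" "s < 1" "0 \<le> s" using r by (auto simp: s_def)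
    have "completely_below L (z r) (z s)"
      unfolding completely_below_def
    proof (intro exI[of _ "\<lambda>t. z (r + t * (s - r))"] conjI ballI impI)
      fix t u :: rat assume tu: "t \<in> {0..1}" "u \<in> {0..1}" "t < u"
      have *: "r + t * (s - r) \<in> {0..1}" if "t \<in> {0..1}" for t
      proof -
        have "t * (s - r) \<le> 1 * (s - r)"
          using that s by (intro mult_right_mono) auto
        moreover have "0 \<le> t * (s - r)"
          using that s by auto
        moreover have "r + 1 * (s - r) \<le> 1" using s by simp
        ultimately show ?thesis using r by (auto intro: order_trans[OF add_left_mono])
      qed
      have "t * (s - r) < u * (s - r)" using tu s by (intro mult_strict_right_mono) auto
      then show "rather_below L (z (r + t * (s - r))) (z (r + u * (s - r)))"
        using z(3) *[OF tu(1)] *[OF tu(2)] by simp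
    qed auto
    then show ?thesis
      using s S by - (rule completely_below_trans_le[of "z r" "z s"], auto intro: sup_upper)
  qed
  then have "\<Squnion>?S \<in> cozero_elements L"
    using S by (intro cozeroI[of ?S]) auto
  moreover have "a \<sqsubseteq> \<Squnion>?S"
    using S z(1) by (intro sup_upper) (auto intro!: image_eqI[of _ _ 0])
  moreover have "\<Squnion>?S \<sqsubseteq> b"
  proof (rule sup_least)
    fix x assume "x \<in> ?S"
    then obtain r where r: "r \<in> {0..<1}" "x = z r" by blast
    then have "rather_below L (z r) (z 1)" using z(3) by simp
    then show "x \<sqsubseteq> b" using r(2) z(2) rather_belowD by simp
  qed (use S zc[of 1] z in auto)
  ultimately show thesis using that by blast
qed

lemma cozero_dense:
  assumes "completely_regular_frame L" "a \<in> carrier L"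
  shows "\<Squnion>{c \<in> cozero_elements L. c \<sqsubseteq> a} = a"
proof (rule le_antisym)
  let ?T = "{c \<in> cozero_elements L. c \<sqsubseteq> a}"
  have T: "?T \<subseteq> carrier L" using cozeroD by blast
  obtain S where S: "S \<subseteq> carrier L" "\<forall>s\<in>S. completely_below L s a" "a = \<Squnion>S"
    using assms unfolding completely_regular_frame_def by blast
  have "\<Squnion>S \<sqsubseteq> \<Squnion>?T"
  proof (rule sup_mono)
    fix s assume "s \<in> S"
    then obtain c where "c \<in> cozero_elements L" "s \<sqsubseteq> c" "c \<sqsubseteq> a"
      using S completely_below_cozero_between by metis
    then show "\<exists>t\<in>?T. s \<sqsubseteq> t" by blast
  qed (use S T in auto)
  then show "a \<sqsubseteq> \<Squnion>?T" using S by simp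
  show "\<Squnion>?T \<sqsubseteq> a" using T assms by (intro sup_least) auto
  show "\<Squnion>?T \<in> carrier L" using T by simp
qed (use assms in auto)

text \<open>Write \<open>c\<close> as a countable join of elements \<open>b\<close> rather below \<open>c\<close>, with witnesses \<open>z\<close>. Since
  \<open>z \<squnion> c\<close> is the top, \<open>S\<close> together with \<open>z\<close> covers the frame, and a countable subcover with \<open>z\<close> removed
  covers \<open>b\<close>, because \<open>b\<close> is disjoint from \<open>z\<close>.\<close>

lemma cozero_lindelof:
  assumes "lindelof_frame L" "c \<in> cozero_elements L" "S \<subseteq> carrier L" "c \<sqsubseteq> \<Squnion>S"
  obtains T where "T \<subseteq> S" "countable T" "c \<sqsubseteq> \<Squnion>T"
proof -
  obtain B where B: "B \<subseteq> carrier L" "countable B" "\<forall>b\<in>B. completely_below L b c" "c = \<Squnion>B"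
    using assms(2) by (elim cozeroE)
  have "\<exists>T\<subseteq>S. countable T \<and> b \<sqsubseteq> \<Squnion>T" if b: "b \<in> B" for b
  proof -
    obtain z where z: "b \<in> carrier L" "z \<in> carrier L" "b \<sqinter> z = \<bottom>" "c \<squnion> z = \<top>"
      using completely_belowD(1) B(3) b unfolding rather_below_def by blast
    have Sz: "insert z S \<subseteq> carrier L" using assms z by auto
    have "\<Squnion>S \<sqsubseteq> \<Squnion>(insert z S)"
      using Sz by (intro sup_subset_mono) auto
    then have "c \<sqsubseteq> \<Squnion>(insert z S)"
      using le_trans[OF assms(4)] cozeroD[OF assms(2)] assms(3) Sz by simp
    moreover have "z \<sqsubseteq> \<Squnion>(insert z S)" using Sz by (intro sup_upper) auto
    ultimately have "c \<squnion> z \<sqsubseteq> \<Squnion>(insert z S)"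
      using Sz z assms cozeroD by (intro join_le) auto
    then have "\<Squnion>(insert z S) = \<top>" using z Sz top_le_iff by simp
    then obtain U where U: "U \<subseteq> insert z S" "countable U" "\<Squnion>U = \<top>"
      using assms(1) Sz unfolding lindelof_frame_def by blast
    let ?T = "U - {z}"
    have T: "?T \<subseteq> S" "countable ?T" "?T \<subseteq> carrier L" using U assms by auto
    have "\<Squnion>U \<sqsubseteq> \<Squnion>?T \<squnion> z"
    proof (rule sup_least)
      fix u assume u: "u \<in> U"
      then show "u \<sqsubseteq> \<Squnion>?T \<squnion> z"
      proof (cases "u = z")
        case True
        then show ?thesis using T z by (auto intro: join_right)
      next
        case False
        then have "u \<sqsubseteq> \<Squnion>?T" using u T by (intro sup_upper) auto
        moreover have "\<Squnion>?T \<sqsubseteq> \<Squnion>?T \<squnion> z" using T z by (intro join_left) auto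
        ultimately show ?thesis
          using T(3) z(2) u U(1) Sz by - (rule le_trans[of u "\<Squnion>?T"], auto)
      qed
    qed (use U Sz T z in auto)
    then have "\<Squnion>?T \<squnion> z = \<top>" using U T z top_le_iff by simp
    then have "b \<sqsubseteq> \<Squnion>?T" using z T by (intro le_of_disjoint_cover[of b _ z]) auto
    then show ?thesis using T by blast
  qed
  then obtain T where T: "\<And>b. b \<in> B \<Longrightarrow> T b \<subseteq> S \<and> countable (T b) \<and> b \<sqsubseteq> \<Squnion>(T b)"
    by metis
  let ?U = "\<Union>b\<in>B. T b"
  have U: "?U \<subseteq> S" "countable ?U" using T B(2) by auto
  have "\<Squnion>B \<sqsubseteq> \<Squnion>?U"
  proof (rule sup_least)
    fix b assume b: "b \<in> B"
    have "\<Squnion>(T b) \<sqsubseteq> \<Squnion>?U" 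
      using b U assms(3) by (intro sup_subset_mono) auto
    then show "b \<sqsubseteq> \<Squnion>?U"
      using T[OF b] U(1) assms(3) b B(1) by - (rule le_trans[of b "\<Squnion>(T b)"], auto)
  qed (use B U assms(3) in auto)
  then show thesis using that U B by simp
qed

text \<open>Countable joins of arbitrary elements need not be cozero, so the countable cover is taken among
  the cozero elements that refine \<open>S\<close>.\<close>

lemma cozero_lindelof_refine:
  assumes "completely_regular_frame L" "lindelof_frame L"
    and "c \<in> cozero_elements L" "S \<subseteq> carrier L" "c \<sqsubseteq> \<Squnion>S"
  obtains T where "T \<subseteq> cozero_elements L" "countable T" "\<forall>t\<in>T. \<exists>s\<in>S. t \<sqsubseteq> s" "c \<sqsubseteq> \<Squnion>T"
proof -
  let ?R = "{t \<in> cozero_elements L. \<exists>s\<in>S. t \<sqsubseteq> s}"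
  have R: "?R \<subseteq> carrier L" using cozero_carrier by auto
  have "\<Squnion>S \<sqsubseteq> \<Squnion>?R"
  proof (rule sup_least)
    fix s assume s: "s \<in> S"
    then have "\<Squnion>{t \<in> cozero_elements L. t \<sqsubseteq> s} \<sqsubseteq> \<Squnion>?R"
      using R by (intro sup_subset_mono) auto
    then show "s \<sqsubseteq> \<Squnion>?R"
      using cozero_dense[OF assms(1)] s assms(4) by auto
  qed (use R assms(4) in auto)
  then have "c \<sqsubseteq> \<Squnion>?R"
    using le_trans[OF assms(5)] cozeroD[OF assms(3)] assms(4) R by simp
  then obtain T where "T \<subseteq> ?R" "countable T" "c \<sqsubseteq> \<Squnion>T"
    using cozero_lindelof[OF assms(2,3) R] by metis
  then show thesis by (intro that[of T]) auto
qed

end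


section \<open>Frame homomorphisms\<close>

locale frame_morphism = M: bare_frame M + N: bare_frame N
  for M :: "'a gorder" and N :: "'b gorder" +
  fixes f :: "'a \<Rightarrow> 'b"
  assumes hom: "frame_hom M N f"
begin

lemma hom_closed [simp]: "a \<in> carrier M \<Longrightarrow> f a \<in> carrier N"
  using hom by (auto simp: frame_hom_def)

lemma hom_image_closed [simp]: "S \<subseteq> carrier M \<Longrightarrow> f ` S \<subseteq> carrier N"
  by auto

lemma hom_top: "f \<top>\<^bsub>M\<^esub> = \<top>\<^bsub>N\<^esub>"
  using hom by (simp add: frame_hom_def)

lemma hom_meet: "\<lbrakk>a \<in> carrier M; b \<in> carrier M\<rbrakk> \<Longrightarrow> f (a \<sqinter>\<^bsub>M\<^esub> b) = f a \<sqinter>\<^bsub>N\<^esub> f b"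
  using hom by (simp add: frame_hom_def)

lemma hom_sup: "S \<subseteq> carrier M \<Longrightarrow> f (\<Squnion>\<^bsub>M\<^esub>S) = \<Squnion>\<^bsub>N\<^esub>(f ` S)"
  using hom by (simp add: frame_hom_def)

lemma hom_join: "\<lbrakk>a \<in> carrier M; b \<in> carrier M\<rbrakk> \<Longrightarrow> f (a \<squnion>\<^bsub>M\<^esub> b) = f a \<squnion>\<^bsub>N\<^esub> f b"
  by (simp add: join_def hom_sup)

lemma hom_bottom: "f \<bottom>\<^bsub>M\<^esub> = \<bottom>\<^bsub>N\<^esub>"
  using hom_sup[of "{}"] by (simp add: M.bottom_eq_sup N.bottom_eq_sup)

lemma hom_mono:
  assumes "a \<sqsubseteq>\<^bsub>M\<^esub> b" "a \<in> carrier M" "b \<in> carrier M"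
  shows "f a \<sqsubseteq>\<^bsub>N\<^esub> f b"
proof -
  have "a \<sqinter>\<^bsub>M\<^esub> b = a"
    using assms M.le_iff_meet_eq by simp
  then have "f a \<sqinter>\<^bsub>N\<^esub> f b = f a"
    using hom_meet[OF assms(2,3)] by simp
  then show ?thesis
    using assms N.le_iff_meet_eq by simp
qed

lemma hom_rather_below:
  assumes "rather_below M a b"
  shows "rather_below N (f a) (f b)"
proof -
  obtain z where z: "a \<in> carrier M" "b \<in> carrier M" "z \<in> carrier M"
    "a \<sqinter>\<^bsub>M\<^esub> z = \<bottom>\<^bsub>M\<^esub>" "b \<squnion>\<^bsub>M\<^esub> z = \<top>\<^bsub>M\<^esub>"
    using assms unfolding rather_below_def by blast
  have "f a \<sqinter>\<^bsub>N\<^esub> f z = \<bottom>\<^bsub>N\<^esub>" "f b \<squnion>\<^bsub>N\<^esub> f z = \<top>\<^bsub>N\<^esub>"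
    using z hom_meet[of a z] hom_join[of b z] hom_bottom hom_top by simp_all
  then show ?thesis
    unfolding rather_below_def using z(1-3) by auto
qed

lemma hom_completely_below:
  assumes "completely_below M a b"
  shows "completely_below N (f a) (f b)"
proof -
  obtain z :: "rat \<Rightarrow> 'a" where z: "z 0 = a" "z 1 = b"
    "\<forall>r\<in>{0..1}. \<forall>s\<in>{0..1}. r < s \<longrightarrow> rather_below M (z r) (z s)"
    using assms unfolding completely_below_def by blast
  then show ?thesis
    unfolding completely_below_def
    by (intro exI[of _ "f \<circ> z"]) (simp add: hom_rather_below)
qed

lemma hom_cozero:
  assumes "c \<in> cozero_elements M"
  shows "f c \<in> cozero_elements N"
proof -
  obtain S where S: "S \<subseteq> carrier M" "countable S" "\<forall>s\<in>S. completely_below M s c" "c = \<Squnion>\<^bsub>M\<^esub>S"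
    using assms by (elim M.cozeroE)
  show ?thesis
  proof (rule N.cozeroI)
    show "f c = \<Squnion>\<^bsub>N\<^esub>(f ` S)" using S(1,4) hom_sup by simp
    show "completely_below N t (f c)" if "t \<in> f ` S" for t
      using that S(3) hom_completely_below by auto
  qed (use S in auto)
qed

lemma surj_completely_regular:
  assumes "completely_regular_frame M" "f ` carrier M = carrier N"
  shows "completely_regular_frame N"
  unfolding completely_regular_frame_def
proof (intro conjI ballI)
  show "frame N" by (rule N.frame_axioms)
  fix b assume "b \<in> carrier N"
  then obtain a where a: "a \<in> carrier M" "b = f a" using assms(2) by blast
  obtain S where S: "S \<subseteq> carrier M" "\<forall>s\<in>S. completely_below M s a" "a = \<Squnion>\<^bsub>M\<^esub>S"
    using assms(1) a(1) unfolding completely_regular_frame_def by blast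
  have "b = \<Squnion>\<^bsub>N\<^esub>(f ` S)" using a(2) S(1,3) hom_sup by simp
  moreover have "\<forall>t\<in>f ` S. completely_below N t b"
    using S(2) a(2) hom_completely_below by auto
  ultimately show "\<exists>T\<subseteq>carrier N. (\<forall>t\<in>T. completely_below N t b) \<and> b = \<Squnion>\<^bsub>N\<^esub>T"
    using S(1) by (intro exI[of _ "f ` S"]) auto
qed

lemma surj_factor_hom:
  assumes surj: "f ` carrier M = carrier N"
    and P: "bare_frame P" and h: "frame_hom M P h"
    and factor: "\<And>a. a \<in> carrier M \<Longrightarrow> g (f a) = h a"
  shows "frame_hom N P g"
proof -
  interpret h: frame_morphism M P h
    by (intro frame_morphism.intro frame_morphism_axioms.intro P h M.bare_frame_axioms)
  show ?thesis
    unfolding frame_hom_def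
  proof (intro conjI ballI allI impI funcsetI)
    fix x assume "x \<in> carrier N"
    then obtain a where a: "a \<in> carrier M" "x = f a" using surj by blast
    then show "g x \<in> carrier P" by (simp add: factor)
    fix y assume "y \<in> carrier N"
    then obtain b where b: "b \<in> carrier M" "y = f b" using surj by blast
    have "g (f a \<sqinter>\<^bsub>N\<^esub> f b) = h (a \<sqinter>\<^bsub>M\<^esub> b)"
      using a(1) b(1) factor[of "a \<sqinter>\<^bsub>M\<^esub> b"] by (simp add: hom_meet)
    then show "g (x \<sqinter>\<^bsub>N\<^esub> y) = g x \<sqinter>\<^bsub>P\<^esub> g y"
      using a b by (simp add: factor h.hom_meet)
  next
    show "g \<top>\<^bsub>N\<^esub> = \<top>\<^bsub>P\<^esub>"
      using factor[of "\<top>\<^bsub>M\<^esub>"] by (simp add: hom_top h.hom_top)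
  next
    fix T assume "T \<subseteq> carrier N"
    then obtain S where S: "S \<subseteq> carrier M" "T = f ` S"
      using surj by (metis subset_imageE)
    have "g ` f ` S = h ` S"
      unfolding image_image using S(1) factor by (intro image_cong) auto
    then show "g (\<Squnion>\<^bsub>N\<^esub>T) = \<Squnion>\<^bsub>P\<^esub>(g ` T)"
      using S factor[of "\<Squnion>\<^bsub>M\<^esub>S"] by (simp add: hom_sup h.hom_sup)
  qed
qed

text \<open>Dense maps are monic on regular frames. If \<open>y\<close> is rather below \<open>x\<close> with witness \<open>z\<close>, then
  \<open>f\<close> sends \<open>k y \<sqinter> l z\<close> to the image of \<open>y \<sqinter> z\<close>, which is the bottom; so density gives
  \<open>k y \<sqinter> l z = \<bottom>\<close>, while \<open>l x \<squnion> l z\<close> is the top. The reverse inequality is obtained by symmetry.\<close>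

lemma dense_hom_agree:
  fixes P :: "'c gorder"
  assumes dense: "\<And>a. \<lbrakk>a \<in> carrier M; f a = \<bottom>\<^bsub>N\<^esub>\<rbrakk> \<Longrightarrow> a = \<bottom>\<^bsub>M\<^esub>"
    and P: "completely_regular_frame P"
    and k: "frame_hom P M k" and l: "frame_hom P M l"
    and eq: "\<And>x. x \<in> carrier P \<Longrightarrow> f (k x) = f (l x)"
    and x: "x \<in> carrier P"
  shows "k x \<sqsubseteq>\<^bsub>M\<^esub> l x"
proof -
  interpret P: bare_frame P
    using P by (simp add: completely_regular_frame_def bare_frame_def)
  interpret k: frame_morphism P M k by unfold_locales (rule k)
  interpret l: frame_morphism P M l by unfold_locales (rule l)
  obtain S where S: "S \<subseteq> carrier P" "\<forall>s\<in>S. completely_below P s x" "x = \<Squnion>\<^bsub>P\<^esub>S"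
    using P x unfolding completely_regular_frame_def by blast
  have le: "k y \<sqsubseteq>\<^bsub>M\<^esub> l x" if "y \<in> S" for y
  proof -
    have "rather_below P y x"
      using that S(2) P.completely_belowD(1) by blast
    then obtain z where z: "y \<in> carrier P" "z \<in> carrier P"
      "y \<sqinter>\<^bsub>P\<^esub> z = \<bottom>\<^bsub>P\<^esub>" "x \<squnion>\<^bsub>P\<^esub> z = \<top>\<^bsub>P\<^esub>"
      unfolding rather_below_def by blast
    have "f (k y \<sqinter>\<^bsub>M\<^esub> l z) = f (k y) \<sqinter>\<^bsub>N\<^esub> f (k z)"
      using z(1,2) by (simp add: hom_meet eq)
    also have "\<dots> = f (k (y \<sqinter>\<^bsub>P\<^esub> z))"
      using z(1,2) by (simp add: hom_meet k.hom_meet)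
    also have "\<dots> = \<bottom>\<^bsub>N\<^esub>"
      using z(3) by (simp add: k.hom_bottom hom_bottom)
    finally have "k y \<sqinter>\<^bsub>M\<^esub> l z = \<bottom>\<^bsub>M\<^esub>"
      using dense z(1,2) by simp
    moreover have "l x \<squnion>\<^bsub>M\<^esub> l z = \<top>\<^bsub>M\<^esub>"
      using l.hom_join[OF x z(2)] z(4) by (simp add: l.hom_top)
    ultimately show ?thesis
      using z(1,2) x by (intro M.le_of_disjoint_cover[of _ _ "l z"]) auto
  qed
  have "k x = \<Squnion>\<^bsub>M\<^esub>(k ` S)"
    using k.hom_sup[OF S(1)] S(3) by simp
  also have "\<dots> \<sqsubseteq>\<^bsub>M\<^esub> l x"
    using le S(1) x by (intro M.sup_least) auto
  finally show ?thesis .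
qed

end


section \<open>Quotients by frame congruences\<close>

lemma (in partial_order) complete_lattice_if_lubs:
  assumes lub: "\<And>A. A \<subseteq> carrier L \<Longrightarrow> \<exists>s. least L s (Upper L A)"
  shows "complete_lattice L"
proof unfold_locales
  fix A assume A: "A \<subseteq> carrier L"
  obtain i where i: "least L i (Upper L (Lower L A))"
    using lub by blast
  have "greatest L i (Lower L A)"
  proof (rule greatest_LowerI)
    fix x assume x: "x \<in> A"
    then have "x \<in> Upper L (Lower L A)" using A by (intro Upper_memI) auto
    then show "i \<sqsubseteq> x" using i by (rule least_le[rotated])
  next
    fix y assume "y \<in> Lower L A"
    then show "y \<sqsubseteq> i" using i by (intro least_Upper_above) auto
  qed (use A i in auto)
  then show "\<exists>i. greatest L i (Lower L A)" ..
qed (rule lub)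

locale frame_quotient = bare_frame +
  fixes C
  assumes cong: "frame_congruence L C"
begin

abbreviation Q where "Q \<equiv> quotient_frame L C"
abbreviation q where "q \<equiv> quotient_map C"

lemma cong_equiv: "equiv (carrier L) C"
  using cong by (simp add: frame_congruence_def)

lemma cong_refl: "a \<in> carrier L \<Longrightarrow> (a, a) \<in> C"
  using cong_equiv by (auto simp: equiv_def refl_on_def)

lemma cong_sym: "(a, b) \<in> C \<Longrightarrow> (b, a) \<in> C"
  using cong_equiv by (auto simp: equiv_def sym_def)

lemma cong_trans: "\<lbrakk>(a, b) \<in> C; (b, c) \<in> C\<rbrakk> \<Longrightarrow> (a, c) \<in> C"
  using cong_equiv unfolding equiv_def trans_def by blast

lemma cong_meet: "\<lbrakk>(a, b) \<in> C; (c, d) \<in> C\<rbrakk> \<Longrightarrow> (a \<sqinter> c, b \<sqinter> d) \<in> C"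
  using cong unfolding frame_congruence_def by blast

lemma cong_sup:
  assumes "\<And>i. i \<in> I \<Longrightarrow> (f i, g i) \<in> C"
  shows "(\<Squnion>(f ` I), \<Squnion>(g ` I)) \<in> C"
proof -
  have "(\<lambda>i. (f i, g i)) ` I \<subseteq> C" using assms by blast
  then have "(\<Squnion>(fst ` (\<lambda>i. (f i, g i)) ` I), \<Squnion>(snd ` (\<lambda>i. (f i, g i)) ` I)) \<in> C"
    using cong unfolding frame_congruence_def by blast
  then show ?thesis by (simp add: image_image)
qed

lemma q_eq_iff: "\<lbrakk>a \<in> carrier L; b \<in> carrier L\<rbrakk> \<Longrightarrow> q a = q b \<longleftrightarrow> (a, b) \<in> C"
  unfolding quotient_map_def by (rule eq_equiv_class_iff[OF cong_equiv])

lemma carrier_Q: "carrier Q = q ` carrier L"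
  by (auto simp: quotient_frame_def quotient_def quotient_map_def)

lemma q_closed: "a \<in> carrier L \<Longrightarrow> q a \<in> carrier Q"
  by (simp add: carrier_Q)

text \<open>The order of the quotient does not depend on representatives, since \<open>C\<close> respects meets.\<close>

lemma q_le_iff:
  assumes "a \<in> carrier L" "b \<in> carrier L"
  shows "q a \<sqsubseteq>\<^bsub>Q\<^esub> q b \<longleftrightarrow> (a \<sqinter> b, a) \<in> C"
proof
  assume "q a \<sqsubseteq>\<^bsub>Q\<^esub> q b"
  then obtain x y where xy: "(a, x) \<in> C" "(b, y) \<in> C" "(x \<sqinter> y, x) \<in> C"
    by (auto simp: quotient_frame_def quotient_map_def)
  have "(a \<sqinter> b, x) \<in> C"
    using cong_trans[OF cong_meet[OF xy(1,2)] xy(3)] .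
  then show "(a \<sqinter> b, a) \<in> C"
    using cong_trans cong_sym xy(1) by blast
next
  assume "(a \<sqinter> b, a) \<in> C"
  then show "q a \<sqsubseteq>\<^bsub>Q\<^esub> q b"
    using assms cong_refl by (auto simp: quotient_frame_def quotient_map_def)
qed

lemma q_mono: "\<lbrakk>a \<in> carrier L; b \<in> carrier L; a \<sqsubseteq> b\<rbrakk> \<Longrightarrow> q a \<sqsubseteq>\<^bsub>Q\<^esub> q b"
  using cong_refl[of a] by (simp add: q_le_iff le_iff_meet_eq)

lemma partial_order_Q: "partial_order Q"
proof
  show "(.=\<^bsub>Q\<^esub>) = (=)"
    by (simp add: quotient_frame_def)
  fix x assume "x \<in> carrier Q"
  then show "x \<sqsubseteq>\<^bsub>Q\<^esub> x" using q_mono by (auto simp: carrier_Q)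
next
  fix x y assume *: "x \<sqsubseteq>\<^bsub>Q\<^esub> y" "y \<sqsubseteq>\<^bsub>Q\<^esub> x" "x \<in> carrier Q" "y \<in> carrier Q"
  then obtain a b where ab: "a \<in> carrier L" "x = q a" "b \<in> carrier L" "y = q b"
    by (auto simp: carrier_Q)
  have "(a \<sqinter> b, a) \<in> C" "(a \<sqinter> b, b) \<in> C"
    using * ab by (simp_all add: q_le_iff) (metis meet_comm)
  then have "(a, b) \<in> C" using cong_sym cong_trans by blast
  then show "x .=\<^bsub>Q\<^esub> y" using ab by (simp add: quotient_frame_def q_eq_iff)
next
  fix x y z assume *: "x \<sqsubseteq>\<^bsub>Q\<^esub> y" "y \<sqsubseteq>\<^bsub>Q\<^esub> z" "x \<in> carrier Q" "y \<in> carrier Q" "z \<in> carrier Q"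
  then obtain a b c where ab: "a \<in> carrier L" "x = q a" "b \<in> carrier L" "y = q b"
      "c \<in> carrier L" "z = q c"
    by (auto simp: carrier_Q)
  have le: "(a \<sqinter> b, a) \<in> C" "(b \<sqinter> c, b) \<in> C"
    using * ab by (simp_all add: q_le_iff)
  have "(a \<sqinter> (b \<sqinter> c), a \<sqinter> b) \<in> C"
    using cong_meet[OF cong_refl[OF ab(1)] le(2)] .
  then have 1: "((a \<sqinter> b) \<sqinter> c, a) \<in> C"
    using ab cong_trans[OF _ le(1)] by (simp add: meet_assoc)
  have "((a \<sqinter> b) \<sqinter> c, a \<sqinter> c) \<in> C"
    using cong_meet[OF le(1) cong_refl[OF ab(5)]] .
  then have "(a \<sqinter> c, a) \<in> C" using 1 cong_sym cong_trans by blast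
  then show "x \<sqsubseteq>\<^bsub>Q\<^esub> z" using ab by (simp add: q_le_iff)
qed (auto simp: quotient_frame_def)

lemma q_lub:
  assumes S: "S \<subseteq> carrier L"
  shows "least Q (q (\<Squnion>S)) (Upper Q (q ` S))"
proof (rule least_UpperI)
  fix x assume "x \<in> q ` S"
  then obtain s where "s \<in> S" "x = q s" by blast
  then show "x \<sqsubseteq>\<^bsub>Q\<^esub> q (\<Squnion>S)" using S sup_upper by (auto intro: q_mono)
next
  fix y assume y: "y \<in> Upper Q (q ` S)"
  then obtain b where b: "b \<in> carrier L" "y = q b"
    by (auto simp: Upper_def carrier_Q)
  have "(b \<sqinter> s, s) \<in> C" if "s \<in> S" for s
  proof -
    have "q s \<sqsubseteq>\<^bsub>Q\<^esub> q b"
      using y that S b by (auto simp: Upper_def carrier_Q)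
    then show ?thesis using that S b q_le_iff[of s b] by (auto simp: meet_comm)
  qed
  then have "(\<Squnion>((\<lambda>s. b \<sqinter> s) ` S), \<Squnion>((\<lambda>s. s) ` S)) \<in> C"
    by (rule cong_sup)
  then have "(\<Squnion>S \<sqinter> b, \<Squnion>S) \<in> C"
    using meet_Sup_distrib[OF b(1) S] by (simp add: meet_comm)
  then show "q (\<Squnion>S) \<sqsubseteq>\<^bsub>Q\<^esub> y"
    using S b by (simp add: q_le_iff)
qed (use S q_closed in auto)

lemma q_glb:
  assumes ab: "a \<in> carrier L" "b \<in> carrier L"
  shows "greatest Q (q (a \<sqinter> b)) (Lower Q {q a, q b})"
proof (rule greatest_LowerI)
  fix x assume "x \<in> {q a, q b}"
  then show "q (a \<sqinter> b) \<sqsubseteq>\<^bsub>Q\<^esub> x"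
    using ab meet_left[OF ab] meet_right[OF ab] by (auto intro: q_mono)
next
  fix y assume y: "y \<in> Lower Q {q a, q b}"
  then obtain c where c: "c \<in> carrier L" "y = q c"
    by (auto simp: Lower_def carrier_Q)
  have "q c \<sqsubseteq>\<^bsub>Q\<^esub> q a" "q c \<sqsubseteq>\<^bsub>Q\<^esub> q b"
    using y ab c q_closed Lower_memD[of y Q "{q a, q b}"] by auto
  then have le: "(c \<sqinter> a, c) \<in> C" "(c \<sqinter> b, c) \<in> C"
    using ab c by (simp_all add: q_le_iff)
  have "((c \<sqinter> a) \<sqinter> b, c \<sqinter> b) \<in> C"
    using cong_meet[OF le(1) cong_refl[OF ab(2)]] .
  then have "(c \<sqinter> (a \<sqinter> b), c) \<in> C"
    using cong_trans[OF _ le(2)] ab c by (simp add: meet_assoc)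
  then show "y \<sqsubseteq>\<^bsub>Q\<^esub> q (a \<sqinter> b)"
    using ab c by (simp add: q_le_iff)
qed (use ab q_closed in auto)

lemma complete_lattice_Q: "complete_lattice Q"
proof (rule partial_order.complete_lattice_if_lubs[OF partial_order_Q])
  fix A assume "A \<subseteq> carrier Q"
  then obtain S where "S \<subseteq> carrier L" "A = q ` S"
    by (metis carrier_Q subset_imageE)
  then show "\<exists>s. least Q s (Upper Q A)" using q_lub by blast
qed

lemma q_sup: "S \<subseteq> carrier L \<Longrightarrow> q (\<Squnion>S) = \<Squnion>\<^bsub>Q\<^esub>(q ` S)"
proof -
  assume S: "S \<subseteq> carrier L"
  interpret Q: complete_lattice Q by (rule complete_lattice_Q)
  show ?thesis
    using Q.least_unique[OF q_lub[OF S] Q.sup_lub] S q_closed by auto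
qed

lemma q_meet: "\<lbrakk>a \<in> carrier L; b \<in> carrier L\<rbrakk> \<Longrightarrow> q (a \<sqinter> b) = q a \<sqinter>\<^bsub>Q\<^esub> q b"
proof -
  assume ab: "a \<in> carrier L" "b \<in> carrier L"
  interpret Q: complete_lattice Q by (rule complete_lattice_Q)
  show ?thesis
    unfolding meet_def[of Q]
    using Q.greatest_unique[OF q_glb[OF ab] Q.inf_glb] ab q_closed by auto
qed

lemma q_top: "q \<top> = \<top>\<^bsub>Q\<^esub>"
proof -
  interpret Q: complete_lattice Q by (rule complete_lattice_Q)
  have "x \<sqsubseteq>\<^bsub>Q\<^esub> q \<top>" if "x \<in> carrier Q" for x
    using that by (auto simp: carrier_Q intro: q_mono)
  then show ?thesis
    using Q.le_antisym[OF Q.top_higher] q_closed by auto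
qed

sublocale Q: bare_frame Q
proof -
  interpret Q: complete_lattice Q by (rule complete_lattice_Q)
  show "bare_frame Q"
  proof unfold_locales
    fix x A assume x: "x \<in> carrier Q" and A: "A \<subseteq> carrier Q"
    obtain S where S: "S \<subseteq> carrier L" "A = q ` S"
      using A by (metis carrier_Q subset_imageE)
    obtain a where a: "a \<in> carrier L" "x = q a" using x by (auto simp: carrier_Q)
    have "x \<sqinter>\<^bsub>Q\<^esub> \<Squnion>\<^bsub>Q\<^esub>A = q (a \<sqinter> \<Squnion>S)"
      using S a by (simp add: q_sup q_meet)
    also have "\<dots> = q (\<Squnion>((\<lambda>s. a \<sqinter> s) ` S))"
      using S a meet_Sup_distrib by simp
    also have "\<dots> = \<Squnion>\<^bsub>Q\<^esub>(q ` (\<lambda>s. a \<sqinter> s) ` S)"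
      using S a by (intro q_sup) auto
    also have "q ` (\<lambda>s. a \<sqinter> s) ` S = (\<lambda>s. x \<sqinter>\<^bsub>Q\<^esub> s) ` A"
      using S a q_meet by (auto simp: image_image intro!: image_cong)
    finally show "x \<sqinter>\<^bsub>Q\<^esub> \<Squnion>\<^bsub>Q\<^esub>A = \<Squnion>\<^bsub>Q\<^esub>((\<lambda>s. x \<sqinter>\<^bsub>Q\<^esub> s) ` A)" .
  qed
qed

sublocale q: frame_morphism L Q q
  by unfold_locales (auto simp: frame_hom_def q_closed q_top q_meet q_sup)

end


section \<open>Congruences generated by cozero elements\<close>

context bare_frame
begin

text \<open>Ensures that the intersection defining \<^const>\<open>iota\<close> is taken over a nonempty family.\<close>

lemma all_congruence: "frame_congruence L (carrier L \<times> carrier L)"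
proof -
  have "fst ` R \<subseteq> carrier L" "snd ` R \<subseteq> carrier L" if "R \<subseteq> carrier L \<times> carrier L" for R
    using that by auto
  then show ?thesis
    by (auto simp: frame_congruence_def equiv_def refl_on_def sym_def trans_def)
qed

lemma subset_iota: "D \<subseteq> iota L D"
  by (auto simp: iota_def)

lemma iota_least: "\<lbrakk>frame_congruence L C; D \<subseteq> C\<rbrakk> \<Longrightarrow> iota L D \<subseteq> C"
  by (auto simp: iota_def)

lemma iota_congruence:
  assumes "D \<subseteq> carrier L \<times> carrier L"
  shows "frame_congruence L (iota L D)"
proof -
  let ?F = "{C. frame_congruence L C \<and> D \<subseteq> C}"
  have sub: "iota L D \<subseteq> carrier L \<times> carrier L"
    using all_congruence assms by (rule iota_least)
  have eq: "equiv (carrier L) C" if "C \<in> ?F" for C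
    using that by (simp add: frame_congruence_def)
  have "refl_on (carrier L) (iota L D)"
    unfolding iota_def refl_on_def using eq by (auto dest: equivp_reflp simp: equiv_def refl_on_def)
  moreover have "sym (iota L D)"
    unfolding iota_def sym_def using eq by (fastforce simp: equiv_def sym_def)
  moreover have "trans (iota L D)"
  proof (rule transI)
    fix a b c assume *: "(a, b) \<in> iota L D" "(b, c) \<in> iota L D"
    have "(a, c) \<in> C" if C: "C \<in> ?F" for C
    proof -
      have "(a, b) \<in> C" "(b, c) \<in> C" using * C unfolding iota_def by auto
      then show ?thesis using eq[OF C] unfolding equiv_def trans_def by blast
    qed
    then show "(a, c) \<in> iota L D" unfolding iota_def by blast
  qed
  ultimately have "equiv (carrier L) (iota L D)"
    using sub by (simp add: equiv_def)
  moreover have "(a \<sqinter> c, b \<sqinter> d) \<in> iota L D"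
    if *: "(a, b) \<in> iota L D" "(c, d) \<in> iota L D" for a b c d
  proof -
    have "(a \<sqinter> c, b \<sqinter> d) \<in> C" if C: "C \<in> ?F" for C
    proof -
      have "(a, b) \<in> C" "(c, d) \<in> C" using * C unfolding iota_def by auto
      then show ?thesis using C unfolding frame_congruence_def by blast
    qed
    then show ?thesis unfolding iota_def by blast
  qed
  moreover have "(\<Squnion>(fst ` R), \<Squnion>(snd ` R)) \<in> iota L D" if R: "R \<subseteq> iota L D" for R
  proof -
    have "(\<Squnion>(fst ` R), \<Squnion>(snd ` R)) \<in> C" if C: "C \<in> ?F" for C
    proof -
      have "R \<subseteq> C" using R C unfolding iota_def by auto
      then show ?thesis using C unfolding frame_congruence_def by blast
    qed
    then show ?thesis unfolding iota_def by blast
  qed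
  ultimately show ?thesis
    unfolding frame_congruence_def by blast
qed

text \<open>Meets and joins in \<^const>\<open>Coz\<close> are computed among the cozero elements only; they agree with those of the
  frame because cozero elements are closed under binary meets and countable joins.\<close>

lemma Coz_meet:
  assumes "a \<in> cozero_elements L" "b \<in> cozero_elements L"
  shows "a \<sqinter>\<^bsub>Coz L\<^esub> b = a \<sqinter> b"
proof -
  have "greatest (Coz L) x (Lower (Coz L) {a, b}) \<longleftrightarrow> x = a \<sqinter> b" for x
  proof
    show "greatest (Coz L) x (Lower (Coz L) {a, b})" if "x = a \<sqinter> b"
      unfolding that greatest_def Lower_def Coz_def
      using assms cozero_meet[OF assms] cozeroD meet_left meet_right meet_le by auto
    assume x: "greatest (Coz L) x (Lower (Coz L) {a, b})"
    then have "x \<in> cozero_elements L" "x \<sqsubseteq> a" "x \<sqsubseteq> b"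
      using assms unfolding greatest_def Lower_def Coz_def by auto
    moreover have "a \<sqinter> b \<sqsubseteq> x"
      using x assms cozero_meet[OF assms] meet_left meet_right cozeroD
      unfolding greatest_def Lower_def Coz_def by auto
    ultimately show "x = a \<sqinter> b"
      using assms cozeroD by (intro le_antisym meet_le) auto
  qed
  then show ?thesis
    unfolding meet_def[of "Coz L"] inf_def by simp
qed

lemma Coz_sup:
  assumes S: "S \<subseteq> cozero_elements L" "countable S"
  shows "\<Squnion>\<^bsub>Coz L\<^esub>S = \<Squnion>S"
proof -
  have SL: "S \<subseteq> carrier L" using S(1) cozero_carrier by blast
  have "least (Coz L) x (Upper (Coz L) S) \<longleftrightarrow> x = \<Squnion>S" for x
  proof
    show "least (Coz L) x (Upper (Coz L) S)" if "x = \<Squnion>S"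
    proof -
      have "\<Squnion>S \<sqsubseteq> y" if "y \<in> cozero_elements L" "\<forall>s. s \<in> S \<and> s \<in> cozero_elements L \<longrightarrow> s \<sqsubseteq> y" for y
        using that S(1) SL cozeroD by (intro sup_least) auto
      then show ?thesis
        unfolding that least_def Upper_def Coz_def
        using cozero_sup[OF S] sup_upper[OF SL] by auto
    qed
    assume x: "least (Coz L) x (Upper (Coz L) S)"
    then have "x \<in> cozero_elements L" "\<And>s. s \<in> S \<Longrightarrow> s \<sqsubseteq> x"
      using S(1) unfolding least_def Upper_def Coz_def by auto
    moreover have "x \<sqsubseteq> \<Squnion>S"
      using x cozero_sup[OF S] sup_upper[OF SL]
      unfolding least_def Upper_def Coz_def by auto
    ultimately show "x = \<Squnion>S"
      using SL cozeroD by (intro le_antisym sup_least) auto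
  qed
  then show ?thesis
    unfolding sup_def[of "Coz L"] by simp
qed

definition coz_part :: "'a rel \<Rightarrow> 'a rel" where
  "coz_part C = C \<inter> cozero_elements L \<times> cozero_elements L"

lemma coz_part_congruence:
  assumes "frame_congruence L C"
  shows "sigma_frame_congruence (Coz L) (coz_part C)"
proof -
  interpret frame_quotient L C by unfold_locales (rule assms)
  have "equiv (cozero_elements L) (coz_part C)"
  proof (rule equivI)
    show "refl_on (cozero_elements L) (coz_part C)"
      using cong_refl cozeroD by (auto simp: coz_part_def refl_on_def)
    show "sym (coz_part C)"
      using cong_sym by (auto simp: coz_part_def sym_def)
    show "trans (coz_part C)"
      by (rule transI) (auto simp: coz_part_def dest: cong_trans)
  qed (auto simp: coz_part_def)
  moreover have "(a \<sqinter>\<^bsub>Coz L\<^esub> c, b \<sqinter>\<^bsub>Coz L\<^esub> d) \<in> coz_part C"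
    if "(a, b) \<in> coz_part C" "(c, d) \<in> coz_part C" for a b c d
    using that cong_meet cozero_meet by (simp add: coz_part_def Coz_meet)
  moreover have "(\<Squnion>\<^bsub>Coz L\<^esub>(fst ` R), \<Squnion>\<^bsub>Coz L\<^esub>(snd ` R)) \<in> coz_part C"
    if R: "R \<subseteq> coz_part C" "countable R" for R
  proof -
    have "fst ` R \<subseteq> cozero_elements L" "snd ` R \<subseteq> cozero_elements L"
      using R(1) by (auto simp: coz_part_def)
    moreover have "(\<Squnion>(fst ` R), \<Squnion>(snd ` R)) \<in> C"
      using R(1) by (intro cong_sup) (auto simp: coz_part_def)
    ultimately show ?thesis
      using R(2) cozero_sup by (simp add: coz_part_def Coz_sup)
  qed
  ultimately show ?thesis
    unfolding sigma_frame_congruence_def by (auto simp: Coz_def)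
qed

text \<open>Both maps are right adjoint to \<open>iota L\<close>: \<open>iota L D \<subseteq> C\<close> holds iff \<open>D \<subseteq> C\<close>, and \<open>D\<close> only relates
  cozero elements. Being right adjoints of one map, they agree.\<close>

lemma iota_star_eq:
  assumes C: "frame_congruence L C"
  shows "iota_star L C = coz_part C"
proof -
  let ?X = "sigma_frame_congruences (Coz L)" and ?Y = "frame_congruences L"
  let ?G = "\<lambda>u. \<lparr>orderA = ?X, orderB = ?Y, lower = iota L, upper = u\<rparr>"
  have car: "D \<subseteq> cozero_elements L \<times> cozero_elements L" if "D \<in> carrier ?X" for D
    using that equiv_type[of "carrier (Coz L)" D]
    by (simp add: sigma_frame_congruences_def sigma_frame_congruence_def Coz_def)
  have adj: "iota L D \<subseteq> B \<longleftrightarrow> D \<subseteq> coz_part B" if "D \<in> carrier ?X" "B \<in> carrier ?Y" for D B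
    using car[OF that(1)] subset_iota[of D] iota_least[of B D] that(2)
    by (auto simp: coz_part_def frame_congruences_def)
  have iota_cl: "iota L D \<in> carrier ?Y" if "D \<in> carrier ?X" for D
    using car[OF that] cozero_carrier iota_congruence[of D]
    by (auto simp: frame_congruences_def)
  have "galois_connection (?G coz_part)"
  proof (rule galois_connection.intro)
    have "partial_order ?X" "partial_order ?Y"
      by unfold_locales (auto simp: sigma_frame_congruences_def frame_congruences_def)
    moreover have "coz_part B \<in> carrier ?X" if "B \<in> carrier ?Y" for B
      using that coz_part_congruence by (simp add: frame_congruences_def sigma_frame_congruences_def)
    ultimately show "connection (?G coz_part)"
      using iota_cl by (intro connection.intro) auto
    show "galois_connection_axioms (?G coz_part)"
      using adj by (simp add: galois_connection_axioms_def frame_congruences_def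
          sigma_frame_congruences_def)
  qed
  then have "galois_connection (?G (iota_star L))"
    unfolding iota_star_def right_adjoint_def by (rule someI[where P = "\<lambda>u. galois_connection (?G u)"])
  then interpret star: galois_connection "?G (iota_star L)" .
  have CY: "C \<in> carrier ?Y" using C by (simp add: frame_congruences_def)
  have star_cl: "iota_star L C \<in> carrier ?X"
    using star.upper_closed[of C] CY by simp
  have star_adj: "iota L D \<subseteq> C \<longleftrightarrow> D \<subseteq> iota_star L C" if "D \<in> carrier ?X" for D
    using star.galois_property[of D C] that CY
    by (simp add: frame_congruences_def sigma_frame_congruences_def)
  show ?thesis
  proof
    show "iota_star L C \<subseteq> coz_part C"
      using star_adj[OF star_cl] adj[OF star_cl CY] by simp
    have "coz_part C \<in> carrier ?X"
      using coz_part_congruence[OF C] by (simp add: sigma_frame_congruences_def)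
    then show "coz_part C \<subseteq> iota_star L C"
      using star_adj adj CY by blast
  qed
qed

text \<open>Any preorder that extends the order and for which binary meets and arbitrary joins keep their
  defining properties is the order of a quotient frame pulled back to \<open>L\<close>.\<close>

lemma congruence_of_preorder:
  assumes le: "\<And>a b. \<lbrakk>a \<in> carrier L; b \<in> carrier L; a \<sqsubseteq> b\<rbrakk> \<Longrightarrow> P a b"
    and trans: "\<And>a b c. \<lbrakk>a \<in> carrier L; b \<in> carrier L; c \<in> carrier L; P a b; P b c\<rbrakk> \<Longrightarrow> P a c"
    and meet: "\<And>a b c. \<lbrakk>a \<in> carrier L; b \<in> carrier L; c \<in> carrier L; P a b; P a c\<rbrakk> \<Longrightarrow> P a (b \<sqinter> c)"
    and sup: "\<And>S b. \<lbrakk>S \<subseteq> carrier L; b \<in> carrier L; \<And>s. s \<in> S \<Longrightarrow> P s b\<rbrakk> \<Longrightarrow> P (\<Squnion>S) b"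
  shows "frame_congruence L {(a, b). a \<in> carrier L \<and> b \<in> carrier L \<and> P a b \<and> P b a}"
    (is "frame_congruence L ?R")
proof -
  have meet_P: "P (a \<sqinter> c) (b \<sqinter> d)"
    if *: "a \<in> carrier L" "b \<in> carrier L" "c \<in> carrier L" "d \<in> carrier L" "P a b" "P c d"
    for a b c d
  proof (rule meet)
    show "P (a \<sqinter> c) b"
      using * le[OF _ _ meet_left] by (intro trans[of "a \<sqinter> c" a b]) auto
    show "P (a \<sqinter> c) d"
      using * le[OF _ _ meet_right] by (intro trans[of "a \<sqinter> c" c d]) auto
  qed (use * in auto)
  have sup_P: "P (\<Squnion>S) (\<Squnion>T)"
    if *: "S \<subseteq> carrier L" "T \<subseteq> carrier L" "\<And>s. s \<in> S \<Longrightarrow> \<exists>t\<in>T. P s t" for S T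
  proof (rule sup)
    fix s assume s: "s \<in> S"
    then obtain t where t: "t \<in> T" "P s t" using *(3) by blast
    then show "P s (\<Squnion>T)"
      using s *(1,2) sup_upper[OF *(2)] by (intro trans[OF _ _ _ t(2) le]) auto
  qed (use * in auto)
  have "equiv (carrier L) ?R"
  proof (rule equivI)
    show "refl_on (carrier L) ?R" using le by (auto simp: refl_on_def)
    show "sym ?R" by (auto simp: sym_def)
    show "trans ?R" by (rule transI) (use trans in blast)
  qed auto
  moreover have "(\<Squnion>(fst ` R), \<Squnion>(snd ` R)) \<in> ?R" if R: "R \<subseteq> ?R" for R
  proof -
    have *: "fst ` R \<subseteq> carrier L" "snd ` R \<subseteq> carrier L" using R by auto
    moreover have "P (\<Squnion>(fst ` R)) (\<Squnion>(snd ` R))" "P (\<Squnion>(snd ` R)) (\<Squnion>(fst ` R))"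
      using R by (intro sup_P *; force)+
    ultimately show ?thesis by simp
  qed
  ultimately show ?thesis
    unfolding frame_congruence_def using meet_P by auto
qed

end


section \<open>The quotient by the cozero part of a congruence\<close>

locale lindelof_quotient = frame_quotient +
  assumes regular: "completely_regular_frame L"
    and lindelof: "lindelof_frame L"
begin

text \<open>Comparison of \<open>\<sigma>\<close>-ideals of cozero elements modulo \<open>C\<close>, an upper bound for the order of the
  quotient by the cozero part of \<open>C\<close>.\<close>

definition coz_le :: "'a \<Rightarrow> 'a \<Rightarrow> bool" where
  "coz_le a b \<longleftrightarrow>
     (\<forall>c\<in>cozero_elements L. c \<sqsubseteq> a \<longrightarrow> (\<exists>d\<in>cozero_elements L. d \<sqsubseteq> b \<and> q c \<sqsubseteq>\<^bsub>Q\<^esub> q d))"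

lemma coz_leE:
  assumes "coz_le a b" "c \<in> cozero_elements L" "c \<sqsubseteq> a"
  obtains d where "d \<in> cozero_elements L" "d \<sqsubseteq> b" "q c \<sqsubseteq>\<^bsub>Q\<^esub> q d"
  using assms unfolding coz_le_def by blast

lemma coz_le_of_q_le:
  assumes "b \<in> cozero_elements L" "a \<in> carrier L" "q a \<sqsubseteq>\<^bsub>Q\<^esub> q b"
  shows "coz_le a b"
  unfolding coz_le_def
proof (intro ballI impI)
  fix c assume c: "c \<in> cozero_elements L" "c \<sqsubseteq> a"
  have "q c \<sqsubseteq>\<^bsub>Q\<^esub> q a"
    using c assms(2) cozeroD by (intro q_mono) auto
  then have "q c \<sqsubseteq>\<^bsub>Q\<^esub> q b"
    using Q.le_trans[OF _ assms(3)] c(1) assms(1,2) cozeroD q_closed by simp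
  then show "\<exists>d\<in>cozero_elements L. d \<sqsubseteq> b \<and> q c \<sqsubseteq>\<^bsub>Q\<^esub> q d"
    using assms(1) cozeroD by blast
qed

text \<open>The one place where the Lindelof property of \<open>L\<close> enters the comparison: a cozero element below
  \<open>\<Squnion>S\<close> is below countably many cozero elements \<open>t\<close> refining \<open>S\<close>, and the cozero elements below \<open>b\<close>
  that dominate these \<open>t\<close> modulo \<open>C\<close> have a cozero join.\<close>

lemma coz_le_sup:
  assumes S: "S \<subseteq> carrier L" and b: "b \<in> carrier L"
    and le: "\<And>s. s \<in> S \<Longrightarrow> coz_le s b"
  shows "coz_le (\<Squnion>S) b"
  unfolding coz_le_def
proof (intro ballI impI)
  fix c assume c: "c \<in> cozero_elements L" "c \<sqsubseteq> \<Squnion>S"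
  obtain T where T: "T \<subseteq> cozero_elements L" "countable T" "\<forall>t\<in>T. \<exists>s\<in>S. t \<sqsubseteq> s" "c \<sqsubseteq> \<Squnion>T"
    using cozero_lindelof_refine[OF regular lindelof c(1) S c(2)] by metis
  have "\<exists>d\<in>cozero_elements L. d \<sqsubseteq> b \<and> q t \<sqsubseteq>\<^bsub>Q\<^esub> q d" if t: "t \<in> T" for t
  proof -
    obtain s where "s \<in> S" "t \<sqsubseteq> s" using T(3) t by blast
    then show ?thesis using le[of s] T(1) t unfolding coz_le_def by blast
  qed
  then obtain d where d: "\<And>t. t \<in> T \<Longrightarrow> d t \<in> cozero_elements L \<and> d t \<sqsubseteq> b \<and> q t \<sqsubseteq>\<^bsub>Q\<^esub> q (d t)"
    by metis
  have dT: "d ` T \<subseteq> cozero_elements L" using d by blast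
  have TL: "T \<subseteq> carrier L" and dTL: "d ` T \<subseteq> carrier L"
    using T(1) dT cozero_carrier by auto
  have "q c \<sqsubseteq>\<^bsub>Q\<^esub> q (\<Squnion>T)"
    using T(4) TL cozeroD[OF c(1)] by (intro q_mono) auto
  also have "q (\<Squnion>T) \<sqsubseteq>\<^bsub>Q\<^esub> q (\<Squnion>(d ` T))"
    unfolding q_sup[OF TL] q_sup[OF dTL]
  proof (rule Q.sup_mono)
    fix y assume "y \<in> q ` T"
    then obtain t where "t \<in> T" "y = q t" by blast
    then show "\<exists>z\<in>q ` d ` T. y \<sqsubseteq>\<^bsub>Q\<^esub> z" using d by blast
  qed (use TL dTL q_closed in auto)
  finally have "q c \<sqsubseteq>\<^bsub>Q\<^esub> q (\<Squnion>(d ` T))"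
    using c(1) cozeroD TL dTL q_closed by simp
  moreover have "\<Squnion>(d ` T) \<in> cozero_elements L"
    using dT T(2) by (intro cozero_sup) auto
  moreover have "\<Squnion>(d ` T) \<sqsubseteq> b"
    using d dTL b by (intro sup_least) auto
  ultimately show "\<exists>d\<in>cozero_elements L. d \<sqsubseteq> b \<and> q c \<sqsubseteq>\<^bsub>Q\<^esub> q d" by blast
qed

lemma coz_le_congruence:
  "frame_congruence L {(a, b). a \<in> carrier L \<and> b \<in> carrier L \<and> coz_le a b \<and> coz_le b a}"
proof (rule congruence_of_preorder)
  fix a b assume ab: "a \<in> carrier L" "b \<in> carrier L" "a \<sqsubseteq> b"
  show "coz_le a b"
    unfolding coz_le_def
  proof (intro ballI impI)
    fix c assume c: "c \<in> cozero_elements L" "c \<sqsubseteq> a"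
    then have "c \<sqsubseteq> b" "q c \<sqsubseteq>\<^bsub>Q\<^esub> q c"
      using ab cozeroD le_trans[OF c(2) ab(3)] q_closed by auto
    then show "\<exists>d\<in>cozero_elements L. d \<sqsubseteq> b \<and> q c \<sqsubseteq>\<^bsub>Q\<^esub> q d"
      using c(1) by blast
  qed
next
  fix a b c assume *: "a \<in> carrier L" "b \<in> carrier L" "c \<in> carrier L" "coz_le a b" "coz_le b c"
  show "coz_le a c"
    unfolding coz_le_def
  proof (intro ballI impI)
    fix x assume x: "x \<in> cozero_elements L" "x \<sqsubseteq> a"
    obtain y where y: "y \<in> cozero_elements L" "y \<sqsubseteq> b" "q x \<sqsubseteq>\<^bsub>Q\<^esub> q y"
      using coz_leE[OF *(4) x] .
    obtain z where z: "z \<in> cozero_elements L" "z \<sqsubseteq> c" "q y \<sqsubseteq>\<^bsub>Q\<^esub> q z"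
      using coz_leE[OF *(5) y(1,2)] .
    have "q x \<sqsubseteq>\<^bsub>Q\<^esub> q z"
      using Q.le_trans[OF y(3) z(3)] x y z cozeroD q_closed by simp
    then show "\<exists>d\<in>cozero_elements L. d \<sqsubseteq> c \<and> q x \<sqsubseteq>\<^bsub>Q\<^esub> q d" using z by blast
  qed
next
  fix a b c assume *: "a \<in> carrier L" "b \<in> carrier L" "c \<in> carrier L" "coz_le a b" "coz_le a c"
  show "coz_le a (b \<sqinter> c)"
    unfolding coz_le_def
  proof (intro ballI impI)
    fix x assume x: "x \<in> cozero_elements L" "x \<sqsubseteq> a"
    obtain y where y: "y \<in> cozero_elements L" "y \<sqsubseteq> b" "q x \<sqsubseteq>\<^bsub>Q\<^esub> q y"
      using coz_leE[OF *(4) x] .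
    obtain z where z: "z \<in> cozero_elements L" "z \<sqsubseteq> c" "q x \<sqsubseteq>\<^bsub>Q\<^esub> q z"
      using coz_leE[OF *(5) x] .
    have "q x \<sqsubseteq>\<^bsub>Q\<^esub> q (y \<sqinter> z)"
      using x y z cozeroD q_closed by (simp add: q_meet Q.meet_le)
    moreover have "y \<sqinter> z \<sqsubseteq> b \<sqinter> c"
      using * y z cozeroD by (intro meet_mono) auto
    ultimately show "\<exists>d\<in>cozero_elements L. d \<sqsubseteq> b \<sqinter> c \<and> q x \<sqsubseteq>\<^bsub>Q\<^esub> q d"
      using cozero_meet[OF y(1) z(1)] by blast
  qed
qed (rule coz_le_sup)

definition E where "E = iota L (coz_part C)"

abbreviation p where "p \<equiv> quotient_map E"
abbreviation K where "K \<equiv> quotient_frame L E"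
abbreviation g where "g \<equiv> induced_quotient_map C"

lemma coz_part_le_E: "coz_part C \<subseteq> E"
  unfolding E_def by (rule subset_iota)

lemma E_le_C: "E \<subseteq> C"
  unfolding E_def by (rule iota_least[OF cong]) (simp add: coz_part_def)

lemma E_coz_le: "(a, b) \<in> E \<Longrightarrow> coz_le a b"
proof -
  have "coz_part C \<subseteq> {(a, b). a \<in> carrier L \<and> b \<in> carrier L \<and> coz_le a b \<and> coz_le b a}"
  proof (clarify, intro conjI)
    fix a b assume ab: "(a, b) \<in> coz_part C"
    then have coz: "a \<in> cozero_elements L" "b \<in> cozero_elements L" and "(a, b) \<in> C"
      by (auto simp: coz_part_def)
    then show car: "a \<in> carrier L" "b \<in> carrier L" using cozeroD by auto
    have "q a = q b" using car \<open>(a, b) \<in> C\<close> by (simp add: q_eq_iff)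
    then show "coz_le a b" "coz_le b a"
      using coz car q_closed by (auto intro: coz_le_of_q_le)
  qed
  then have "E \<subseteq> {(a, b). a \<in> carrier L \<and> b \<in> carrier L \<and> coz_le a b \<and> coz_le b a}"
    unfolding E_def by (rule iota_least[OF coz_le_congruence])
  then show "(a, b) \<in> E \<Longrightarrow> coz_le a b" by auto
qed

sublocale E: frame_quotient L E
proof
  have "coz_part C \<subseteq> carrier L \<times> carrier L"
    using cozeroD by (auto simp: coz_part_def)
  then show "frame_congruence L E"
    unfolding E_def by (rule iota_congruence)
qed

text \<open>An identification of two cozero elements by \<open>C\<close> is one of the generators of \<open>E\<close>.\<close>

lemma p_eq_if_q_eq:
  assumes "c \<in> cozero_elements L" "d \<in> cozero_elements L" "q c = q d"
  shows "p c = p d"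
proof -
  have "(c, d) \<in> coz_part C"
    using assms cozeroD by (simp add: coz_part_def q_eq_iff[symmetric])
  then show ?thesis
    using coz_part_le_E assms cozeroD by (auto simp: E.q_eq_iff)
qed

lemma p_le_if_q_le:
  assumes c: "c \<in> cozero_elements L" and d: "d \<in> cozero_elements L" and le: "q c \<sqsubseteq>\<^bsub>Q\<^esub> q d"
  shows "p c \<sqsubseteq>\<^bsub>K\<^esub> p d"
proof -
  have "q (c \<sqinter> d) = q c"
    using le c d cozeroD q_closed by (simp add: q_meet Q.le_iff_meet_eq)
  then have "p (c \<sqinter> d) = p c"
    using c d cozero_meet by (intro p_eq_if_q_eq) auto
  then show ?thesis
    using c d cozeroD E.q_closed by (simp add: E.q_meet E.Q.le_iff_meet_eq)
qed

lemma g_p: "a \<in> carrier L \<Longrightarrow> g (p a) = q a"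
  using induced_quotient_map_quotient_map[OF E.cong_equiv cong_equiv E_le_C] .

lemma g_hom: "frame_hom K Q g"
  using E.q.surj_factor_hom[of Q q g] E.carrier_Q Q.bare_frame_axioms q.hom g_p by auto

text \<open>An element of \<open>L\<close> killed by \<open>C\<close> has all its cozero parts killed by \<open>C\<close>, hence by \<open>E\<close>, and it is
  their join.\<close>

lemma g_dense:
  assumes "x \<in> carrier K" "g x = \<bottom>\<^bsub>Q\<^esub>"
  shows "x = \<bottom>\<^bsub>K\<^esub>"
proof -
  obtain a where a: "a \<in> carrier L" "x = p a" using assms(1) E.carrier_Q by auto
  let ?S = "{c \<in> cozero_elements L. c \<sqsubseteq> a}"
  have S: "?S \<subseteq> carrier L" using cozeroD by auto
  have qa: "q a = q \<bottom>" using assms(2) a g_p q.hom_bottom by simp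
  have "p c \<sqsubseteq>\<^bsub>K\<^esub> \<bottom>\<^bsub>K\<^esub>" if c: "c \<in> ?S" for c
  proof -
    have "q c \<sqsubseteq>\<^bsub>Q\<^esub> q \<bottom>"
      unfolding qa[symmetric] using c a cozeroD by (intro q_mono) auto
    then have "p c \<sqsubseteq>\<^bsub>K\<^esub> p \<bottom>"
      using c cozero_bottom by (intro p_le_if_q_le) auto
    then show ?thesis by (simp add: E.q.hom_bottom)
  qed
  then have "\<Squnion>\<^bsub>K\<^esub>(p ` ?S) \<sqsubseteq>\<^bsub>K\<^esub> \<bottom>\<^bsub>K\<^esub>"
    using S by (intro E.Q.sup_least) auto
  moreover have "x = \<Squnion>\<^bsub>K\<^esub>(p ` ?S)"
    using E.q_sup[OF S] cozero_dense[OF regular a(1)] a(2) by simp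
  ultimately show ?thesis using assms(1) E.Q.le_bottom_iff by metis
qed

lemma K_regular: "completely_regular_frame K"
  using E.q.surj_completely_regular[OF regular] E.carrier_Q by simp

lemma Q_regular: "completely_regular_frame Q"
  using q.surj_completely_regular[OF regular] carrier_Q by simp

text \<open>Both bounds on \<open>E\<close> are used: the bound by \<open>coz_le\<close> produces a cozero element \<open>d\<close> below the given join
  that \<open>C\<close> identifies with the top, and then \<open>E\<close> identifies \<open>d\<close> with the top as well, since both are
  cozero.\<close>

lemma K_lindelof: "lindelof_frame K"
  unfolding lindelof_frame_def
proof (intro conjI allI impI)
  show "frame K" by (rule E.Q.frame_axioms)
  fix A assume A: "A \<subseteq> carrier K" "\<Squnion>\<^bsub>K\<^esub>A = \<top>\<^bsub>K\<^esub>"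
  obtain S where S: "S \<subseteq> carrier L" "A = p ` S"
    using A(1) E.carrier_Q by (metis subset_imageE)
  have "p \<top> = p (\<Squnion>S)" using A(2) S by (simp add: E.q_sup E.q_top)
  then have "coz_le \<top> (\<Squnion>S)" using S(1) E_coz_le E.q_eq_iff by simp
  then obtain d where d: "d \<in> cozero_elements L" "d \<sqsubseteq> \<Squnion>S" "q \<top> \<sqsubseteq>\<^bsub>Q\<^esub> q d"
    using coz_leE[of \<top> "\<Squnion>S" \<top>] cozero_top by auto
  obtain T where T: "T \<subseteq> S" "countable T" "d \<sqsubseteq> \<Squnion>T"
    using cozero_lindelof[OF lindelof d(1) S(1) d(2)] .
  have TL: "T \<subseteq> carrier L" using T(1) S(1) by auto
  have "p \<top> \<sqsubseteq>\<^bsub>K\<^esub> p d"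
    using cozero_top d(1,3) by (rule p_le_if_q_le)
  moreover have "p d \<sqsubseteq>\<^bsub>K\<^esub> p (\<Squnion>T)"
    using T(3) TL cozeroD[OF d(1)] by (intro E.q_mono) auto
  ultimately have "\<top>\<^bsub>K\<^esub> \<sqsubseteq>\<^bsub>K\<^esub> p (\<Squnion>T)"
    using E.Q.le_trans[of "p \<top>" "p d" "p (\<Squnion>T)"] cozeroD[OF d(1)] TL E.q_closed by (simp add: E.q_top)
  then have "\<Squnion>\<^bsub>K\<^esub>(p ` T) = \<top>\<^bsub>K\<^esub>"
    using TL E.q_closed E.Q.top_le_iff by (simp add: E.q_sup)
  then show "\<exists>T\<subseteq>A. countable T \<and> \<Squnion>\<^bsub>K\<^esub>T = \<top>\<^bsub>K\<^esub>"
    using T(1,2) S(2) by (intro exI[of _ "p ` T"]) auto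
qed

end


section \<open>The universal property\<close>

locale lindelof_lift = lindelof_quotient + N: bare_frame N for N :: "'c gorder" +
  fixes h :: "'c \<Rightarrow> 'a set"
  assumes onto: "coz_onto L Q q"
    and N_regular: "completely_regular_frame N" and N_lindelof: "lindelof_frame N"
    and h_hom: "frame_hom N Q h"
begin

sublocale h: frame_morphism N Q h
  by unfold_locales (rule h_hom)

lemma cozero_lift:
  assumes "c \<in> cozero_elements N"
  obtains d where "d \<in> cozero_elements L" "h c = q d"
  using h.hom_cozero[OF assms] onto by (auto simp: coz_onto_def Coz_def)

text \<open>Taking all representatives of all cozero elements below \<open>x\<close> avoids choosing one for each.\<close>

definition lifts :: "'c \<Rightarrow> 'a set" where
  "lifts x = {d \<in> cozero_elements L. \<exists>c\<in>cozero_elements N. c \<sqsubseteq>\<^bsub>N\<^esub> x \<and> h c = q d}"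

definition lift :: "'c \<Rightarrow> 'a set" where
  "lift x = \<Squnion>\<^bsub>K\<^esub>(p ` lifts x)"

lemma lifts_carrier: "lifts x \<subseteq> carrier L"
  using cozeroD by (auto simp: lifts_def)

lemma p_lifts_carrier: "p ` lifts x \<subseteq> carrier K"
  using lifts_carrier E.q_closed by auto

lemma lift_closed: "lift x \<in> carrier K"
  using p_lifts_carrier by (simp add: lift_def)

lemma p_le_lift: "d \<in> lifts x \<Longrightarrow> p d \<sqsubseteq>\<^bsub>K\<^esub> lift x"
  unfolding lift_def using p_lifts_carrier by (intro E.Q.sup_upper) auto

lemma lift_mono:
  assumes "x \<sqsubseteq>\<^bsub>N\<^esub> y" "x \<in> carrier N" "y \<in> carrier N"
  shows "lift x \<sqsubseteq>\<^bsub>K\<^esub> lift y"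
proof -
  have "lifts x \<subseteq> lifts y"
    using N.le_trans[OF _ assms(1)] assms(2,3) N.cozeroD unfolding lifts_def by blast
  then show ?thesis
    unfolding lift_def using p_lifts_carrier by (intro E.Q.sup_subset_mono) auto
qed

lemma lift_top: "lift \<top>\<^bsub>N\<^esub> = \<top>\<^bsub>K\<^esub>"
proof -
  have "\<top> \<in> lifts \<top>\<^bsub>N\<^esub>"
    unfolding lifts_def using cozero_top N.cozero_top
    by (auto intro!: bexI[of _ "\<top>\<^bsub>N\<^esub>"] simp: h.hom_top q_top)
  then have "p \<top> \<sqsubseteq>\<^bsub>K\<^esub> lift \<top>\<^bsub>N\<^esub>" by (rule p_le_lift)
  then show ?thesis using lift_closed E.Q.top_le_iff by (simp add: E.q_top)
qed

lemma lift_meet: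
  assumes xy: "x \<in> carrier N" "y \<in> carrier N"
  shows "lift (x \<sqinter>\<^bsub>N\<^esub> y) = lift x \<sqinter>\<^bsub>K\<^esub> lift y"
proof (rule E.Q.le_antisym)
  show "lift (x \<sqinter>\<^bsub>N\<^esub> y) \<sqsubseteq>\<^bsub>K\<^esub> lift x \<sqinter>\<^bsub>K\<^esub> lift y"
    using xy lift_closed by (intro E.Q.meet_le lift_mono N.meet_left N.meet_right) auto
  let ?U = "{s \<sqinter>\<^bsub>K\<^esub> t | s t. s \<in> p ` lifts x \<and> t \<in> p ` lifts y}"
  have "lift x \<sqinter>\<^bsub>K\<^esub> lift y = \<Squnion>\<^bsub>K\<^esub>?U"
    unfolding lift_def by (rule E.Q.sup_meet_sup[OF p_lifts_carrier p_lifts_carrier])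
  also have "\<dots> \<sqsubseteq>\<^bsub>K\<^esub> lift (x \<sqinter>\<^bsub>N\<^esub> y)"
  proof (rule E.Q.sup_least)
    show "?U \<subseteq> carrier K"
      using p_lifts_carrier[of x] p_lifts_carrier[of y] by (auto intro!: E.Q.meet_closed)
    fix u assume "u \<in> ?U"
    then obtain d e where de: "d \<in> lifts x" "e \<in> lifts y" "u = p d \<sqinter>\<^bsub>K\<^esub> p e" by blast
    obtain a where a: "a \<in> cozero_elements N" "a \<sqsubseteq>\<^bsub>N\<^esub> x" "h a = q d" "d \<in> cozero_elements L"
      using de(1) by (auto simp: lifts_def)
    obtain b where b: "b \<in> cozero_elements N" "b \<sqsubseteq>\<^bsub>N\<^esub> y" "h b = q e" "e \<in> cozero_elements L"
      using de(2) by (auto simp: lifts_def)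
    have "a \<sqinter>\<^bsub>N\<^esub> b \<sqsubseteq>\<^bsub>N\<^esub> x \<sqinter>\<^bsub>N\<^esub> y"
      using a b xy N.cozeroD by (intro N.meet_mono) auto
    moreover have "h (a \<sqinter>\<^bsub>N\<^esub> b) = q (d \<sqinter> e)"
      using a b cozeroD N.cozeroD by (simp add: h.hom_meet q_meet)
    ultimately have "d \<sqinter> e \<in> lifts (x \<sqinter>\<^bsub>N\<^esub> y)"
      using a b cozero_meet N.cozero_meet unfolding lifts_def by blast
    then have "p (d \<sqinter> e) \<sqsubseteq>\<^bsub>K\<^esub> lift (x \<sqinter>\<^bsub>N\<^esub> y)" by (rule p_le_lift)
    then show "u \<sqsubseteq>\<^bsub>K\<^esub> lift (x \<sqinter>\<^bsub>N\<^esub> y)"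
      using de(3) a(4) b(4) cozeroD by (simp add: E.q_meet)
  qed (rule lift_closed)
  finally show "lift x \<sqinter>\<^bsub>K\<^esub> lift y \<sqsubseteq>\<^bsub>K\<^esub> lift (x \<sqinter>\<^bsub>N\<^esub> y)" .
qed (use lift_closed in auto)

text \<open>A cozero \<open>c\<close> below \<open>\<Squnion>S\<close> is covered by countably many cozero \<open>t\<close> refining \<open>S\<close>. Representatives
  \<open>e t\<close> of the \<open>h t\<close> have a cozero join, so the inequality between a representative of \<open>h c\<close> and that join
  holds modulo \<open>E\<close> and not only modulo \<open>C\<close>.\<close>

lemma lift_sup:
  assumes S: "S \<subseteq> carrier N"
  shows "lift (\<Squnion>\<^bsub>N\<^esub>S) = \<Squnion>\<^bsub>K\<^esub>(lift ` S)"
proof (rule E.Q.le_antisym)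
  have kS: "lift ` S \<subseteq> carrier K" using lift_closed by auto
  then show "\<Squnion>\<^bsub>K\<^esub>(lift ` S) \<in> carrier K" by simp
  show "lift (\<Squnion>\<^bsub>N\<^esub>S) \<in> carrier K" by (rule lift_closed)
  show "\<Squnion>\<^bsub>K\<^esub>(lift ` S) \<sqsubseteq>\<^bsub>K\<^esub> lift (\<Squnion>\<^bsub>N\<^esub>S)"
  proof (rule E.Q.sup_least[OF kS lift_closed])
    fix y assume "y \<in> lift ` S"
    then obtain s where s: "s \<in> S" "y = lift s" by blast
    show "y \<sqsubseteq>\<^bsub>K\<^esub> lift (\<Squnion>\<^bsub>N\<^esub>S)"
      unfolding s(2) using S s(1) by (intro lift_mono N.sup_upper) auto
  qed
  show "lift (\<Squnion>\<^bsub>N\<^esub>S) \<sqsubseteq>\<^bsub>K\<^esub> \<Squnion>\<^bsub>K\<^esub>(lift ` S)"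
    unfolding lift_def[of "\<Squnion>\<^bsub>N\<^esub>S"]
  proof (rule E.Q.sup_least[OF p_lifts_carrier])
    fix u assume "u \<in> p ` lifts (\<Squnion>\<^bsub>N\<^esub>S)"
    then obtain d c where d: "d \<in> cozero_elements L" "u = p d"
      and c: "c \<in> cozero_elements N" "c \<sqsubseteq>\<^bsub>N\<^esub> \<Squnion>\<^bsub>N\<^esub>S" "h c = q d"
      by (auto simp: lifts_def)
    obtain T where T: "T \<subseteq> cozero_elements N" "countable T" "\<forall>t\<in>T. \<exists>s\<in>S. t \<sqsubseteq>\<^bsub>N\<^esub> s"
        "c \<sqsubseteq>\<^bsub>N\<^esub> \<Squnion>\<^bsub>N\<^esub>T"
      using N.cozero_lindelof_refine[OF N_regular N_lindelof c(1) S c(2)] .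
    have TN: "T \<subseteq> carrier N" using T(1) N.cozero_carrier by auto
    have "\<exists>e\<in>cozero_elements L. h t = q e" if "t \<in> T" for t
      using that T(1) cozero_lift[of t] by blast
    then obtain e where e: "\<And>t. t \<in> T \<Longrightarrow> e t \<in> cozero_elements L \<and> h t = q (e t)"
      by metis
    have eT: "e ` T \<subseteq> cozero_elements L" "e ` T \<subseteq> carrier L" using e cozeroD by auto
    have "h ` T = q ` e ` T" unfolding image_image using e by (intro image_cong) auto
    then have hT: "h (\<Squnion>\<^bsub>N\<^esub>T) = q (\<Squnion>(e ` T))"
      by (simp only: h.hom_sup[OF TN] q_sup[OF eT(2)])
    have "h c \<sqsubseteq>\<^bsub>Q\<^esub> h (\<Squnion>\<^bsub>N\<^esub>T)"
      using T(4) N.cozeroD[OF c(1)] TN by (intro h.hom_mono) auto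
    then have "q d \<sqsubseteq>\<^bsub>Q\<^esub> q (\<Squnion>(e ` T))" by (simp only: hT c(3))
    then have "p d \<sqsubseteq>\<^bsub>K\<^esub> p (\<Squnion>(e ` T))"
      using d(1) eT(1) T(2) by (intro p_le_if_q_le cozero_sup) auto
    also have "p (\<Squnion>(e ` T)) = \<Squnion>\<^bsub>K\<^esub>(p ` e ` T)"
      using eT(2) by (rule E.q_sup)
    also have "\<dots> \<sqsubseteq>\<^bsub>K\<^esub> \<Squnion>\<^bsub>K\<^esub>(lift ` S)"
    proof (rule E.Q.sup_mono[OF _ kS])
      show "p ` e ` T \<subseteq> carrier K" using eT(2) E.q_closed by auto
      fix v assume "v \<in> p ` e ` T"
      then obtain t where t: "t \<in> T" "v = p (e t)" by blast
      then obtain s where s: "s \<in> S" "t \<sqsubseteq>\<^bsub>N\<^esub> s" using T(3) by blast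
      have "e t \<in> lifts s" using e[OF t(1)] s(2) t(1) T(1) by (auto simp: lifts_def)
      then have "v \<sqsubseteq>\<^bsub>K\<^esub> lift s" unfolding t(2) by (rule p_le_lift)
      then show "\<exists>y\<in>lift ` S. v \<sqsubseteq>\<^bsub>K\<^esub> y" using s(1) by blast
    qed
    finally show "u \<sqsubseteq>\<^bsub>K\<^esub> \<Squnion>\<^bsub>K\<^esub>(lift ` S)"
      using d cozeroD eT(2) E.q_closed kS by simp
  qed (use kS in auto)
qed

lemma lift_hom: "frame_hom N K lift"
  using lift_closed lift_top lift_meet lift_sup by (auto simp: frame_hom_def)

lemma g_lift:
  assumes x: "x \<in> carrier N"
  shows "g (lift x) = h x"
proof -
  interpret g: frame_morphism K Q g by unfold_locales (rule g_hom)
  let ?S = "{c \<in> cozero_elements N. c \<sqsubseteq>\<^bsub>N\<^esub> x}"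
  have S: "?S \<subseteq> carrier N" using N.cozeroD by auto
  have "g (lift x) = \<Squnion>\<^bsub>Q\<^esub>(g ` p ` lifts x)"
    unfolding lift_def by (rule g.hom_sup[OF p_lifts_carrier])
  also have "g ` p ` lifts x = q ` lifts x"
    unfolding image_image using lifts_carrier g_p by (intro image_cong) auto
  also have "q ` lifts x = h ` ?S"
  proof
    show "q ` lifts x \<subseteq> h ` ?S" by (auto simp: lifts_def) 
    show "h ` ?S \<subseteq> q ` lifts x"
    proof
      fix y assume "y \<in> h ` ?S"
      then obtain c where c: "c \<in> ?S" "y = h c" by blast
      then obtain d where "d \<in> cozero_elements L" "h c = q d" using cozero_lift[of c] by auto
      then show "y \<in> q ` lifts x" using c by (auto simp: lifts_def)
    qed
  qed
  also have "\<Squnion>\<^bsub>Q\<^esub>(h ` ?S) = h (\<Squnion>\<^bsub>N\<^esub>?S)"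
    by (rule h.hom_sup[OF S, symmetric])
  also have "\<Squnion>\<^bsub>N\<^esub>?S = x"
    by (rule N.cozero_dense[OF N_regular x])
  finally show ?thesis .
qed

lemma unique_factorisation:
  "\<exists>!k. k \<in> extensional (carrier N) \<and> frame_hom N K k \<and> (\<forall>x\<in>carrier N. g (k x) = h x)"
proof (rule ex1I)
  let ?k = "restrict lift (carrier N)"
  have "frame_hom N K ?k"
    using lift_hom unfolding frame_hom_def by (auto simp: restrict_def image_def subset_iff)
  then show "?k \<in> extensional (carrier N) \<and> frame_hom N K ?k \<and> (\<forall>x\<in>carrier N. g (?k x) = h x)"
    using g_lift by simp
next
  interpret g: frame_morphism K Q g by unfold_locales (rule g_hom)
  fix l assume l: "l \<in> extensional (carrier N) \<and> frame_hom N K l \<and> (\<forall>x\<in>carrier N. g (l x) = h x)"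
  show "l = restrict lift (carrier N)"
  proof (rule extensionalityI)
    fix x assume x: "x \<in> carrier N"
    have "l x \<sqsubseteq>\<^bsub>K\<^esub> lift x" "lift x \<sqsubseteq>\<^bsub>K\<^esub> l x"
      using g.dense_hom_agree[OF g_dense N_regular _ _ _ x] l lift_hom g_lift by simp_all
    moreover have "l x \<in> carrier K" using l x by (auto simp: frame_hom_def)
    ultimately show "l x = restrict lift (carrier N) x"
      using x lift_closed E.Q.le_antisym by simp
  qed (use l in auto)
qed

end

theorem mainTheorem19:
  fixes L :: "'a gorder" and C :: "'a rel"
  assumes "completely_regular_frame L" and "lindelof_frame L"
    and "frame_congruence L C"
    and "coz_onto L (quotient_frame L C) (quotient_map C)"
  shows "universal_lindelofication TYPE('c)
           (quotient_frame L (iota L (iota_star L C)))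
           (quotient_frame L C)
           (induced_quotient_map C)"
proof -
  interpret bare_frame L
    using assms(1) by (simp add: completely_regular_frame_def bare_frame_def)
  interpret lindelof_quotient L C
    by unfold_locales (rule assms)+
  have "\<exists>!k. k \<in> extensional (carrier N) \<and> frame_hom N K k \<and> (\<forall>x\<in>carrier N. g (k x) = h x)"
    if "completely_regular_frame N" "lindelof_frame N" "frame_hom N Q h" for N :: "'c gorder" and h
  proof -
    interpret N: bare_frame N
      using that(1) by (simp add: completely_regular_frame_def bare_frame_def)
    interpret lindelof_lift L C N h
      by unfold_locales (rule assms that)+
    show ?thesis by (rule unique_factorisation)
  qed
  then have "universal_lindelofication TYPE('c) K Q g"
    unfolding universal_lindelofication_def
    using K_regular Q_regular K_lindelof g_hom by blast
  then show ?thesis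
    by (simp add: E_def iota_star_eq[OF assms(3)])
qed

end
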